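(* Let $(X,T)$ be a minimal Floyd-Auslander system, given by a sequence $(p_n)_{n\in\mathbb N}$ and maps $\lambda^n_j$ ($n\in\mathbb N$, $j\in\{0,\ldots,p_n-1\}$), and let $Q(n)=\{j\in\{0,\ldots,p_n-1\}:\lambda^n_j=\lambda_1\}$. Then the following statements are equivalent. (1) $(X,T)$ is non-tame. (2) The set $J^{\mathrm{min}}(X)$ of minimal idempotents of the Ellis semigroup $E(X)$ is large: $|J^{\mathrm{min}}(X)|>2^{\aleph_0}$. (3) The set $\Lambda=\{n\in\mathbb N: |Q(n)|\geq 2\}$ is infinite.
   Context: Floyd-Auslander systems. Let $\mathbb N=\{1,2,\ldots\}$ and let $(p_n)_{n\in\mathbb N}$ be a sequence of integers $p_n>1$; write $[p_n]=\{0,1,\ldots,p_n-1\}$. Let $\Sigma_{(p_n)}=\prod_{n\in\mathbb N}[p_n]$ (product topology) be the odometer group, with addition coordinatewise modulo $p_n$ with carry to the right (from position $n$ to position $n+1$), and let $\underline 1=(1,0,0,\ldots)$. Let $\lambda_0,\lambda_1,\lambda_2:[0,1]\to[0,1]$ be $\lambda_0(x)=\frac12x$, $\lambda_1(x)=x$, $\lambda_2(x)=\frac12x+\frac12$. For each $n\in\mathbb N$ and $j\in[p_n]$ let $\lambda^n_j\in\{\lambda_0,\lambda_1,\lambda_2\}$ be given. For $\alpha\in\Sigma_{(p_n)}$ set $\lambda^n_\alpha=\lambda^1_{\alpha_1}\circ\cdots\circ\lambda^n_{\alpha_n}$, and let $X=\{(\alpha,y)\in\Sigma_{(p_n)}\times[0,1]: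 y=\lim_{n\to\infty}\lambda^n_\alpha(z)\text{ for some }z\in[0,1]\}$, which is compact. Define $T:X\to X$ by $T(\alpha,y)=(\alpha+\underline 1,\lim_{n\to\infty}\lambda^n_{\alpha+\underline 1}(z))$, where $z$ is such that $y=\lim_{n\to\infty}\lambda^n_\alpha(z)$. $(X,T)$ is called a Floyd-Auslander system if: (i) there are infinitely many $n$ with $\lambda^n_0\in\{\lambda_0,\lambda_2\}$ and infinitely many $m$ with $\lambda^m_{p_m-1}\in\{\lambda_0,\lambda_2\}$ (this makes $T$ well defined and continuous); and (ii) there are at most finitely many $n$ with $Q(n)=\emptyset$. Minimal means that all orbits are dense. Ellis semigroup. $E(X)=\overline{\{T^n:n\in\mathbb N\}}\subseteq X^X$, closure in the product topology, with composition as the operation. $(X,T)$ is non-tame if $E(X)$ contains a (topological) copy of the Stone-Čech compactification $\beta\mathbb N$ of $\mathbb N$, and tame otherwise. $J(X)$ is the set of idempotents of $E(X)$ (elements $f$ with $f\circ f=f$). For $e,f\in J(X)$ write $e\le f$ if $e=e\circ f$. An idempotent $f$ is minimal if it is minimal with respect to $\le$, i.e. for every $e\in J(X)$, $e\le f$ implies $f\le e$. $J^{\mathrm{min}}(X)$ is the set of minimal idempotents. *)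

theory Defs
  imports "HOL-Analysis.Analysis" "HOL-Library.Equipollence"
begin

text \<open>
  Positions are counted from 0: \<open>p n\<close>, \<open>\<alpha> n\<close> and \<open>lam n j\<close> below stand for what is
  written with the index \<open>n + 1\<close> when positions are counted from 1.
\<close>

definition odometer :: "(nat \<Rightarrow> nat) \<Rightarrow> (nat \<Rightarrow> nat) set" where
  "odometer p = {\<alpha>. \<forall>n. \<alpha> n < p n}"

primrec odo_carry :: "(nat \<Rightarrow> nat) \<Rightarrow> (nat \<Rightarrow> nat) \<Rightarrow> (nat \<Rightarrow> nat) \<Rightarrow> nat \<Rightarrow> nat" where
  "odo_carry p \<alpha> \<beta> 0 = 0"
| "odo_carry p \<alpha> \<beta> (Suc n) = (\<alpha> n + \<beta> n + odo_carry p \<alpha> \<beta> n) div p n"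

definition odo_add :: "(nat \<Rightarrow> nat) \<Rightarrow> (nat \<Rightarrow> nat) \<Rightarrow> (nat \<Rightarrow> nat) \<Rightarrow> nat \<Rightarrow> nat" where
  "odo_add p \<alpha> \<beta> n = (\<alpha> n + \<beta> n + odo_carry p \<alpha> \<beta> n) mod p n"

definition odo_one :: "nat \<Rightarrow> nat" where
  "odo_one n = (if n = 0 then 1 else 0)"

text \<open>
  The three affine self-maps of \<open>[0,1]\<close> are given by their formulas on all of \<open>\<real>\<close>;
  they are only ever evaluated on \<open>[0,1]\<close>.  They differ pairwise already there, so
  equations between them mean the same as equations between their restrictions.
\<close>

definition lam0 :: "real \<Rightarrow> real" where "lam0 x = 1/2 * x"
definition lam1 :: "real \<Rightarrow> real" where "lam1 x = x"
definition lam2 :: "real \<Rightarrow> real" where "lam2 x = 1/2 * x + 1/2"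

primrec lam_comp :: "(nat \<Rightarrow> nat \<Rightarrow> real \<Rightarrow> real) \<Rightarrow> (nat \<Rightarrow> nat) \<Rightarrow> nat \<Rightarrow> real \<Rightarrow> real" where
  "lam_comp lam \<alpha> 0 = id"
| "lam_comp lam \<alpha> (Suc n) = lam_comp lam \<alpha> n \<circ> lam n (\<alpha> n)"

text \<open>
  The topology on the type \<open>(nat \<Rightarrow> nat) \<times> real\<close> is the product topology with \<open>nat\<close> discrete,
  so it induces on \<open>fa_space p lam\<close> the topology of a subspace of the odometer times \<open>[0,1]\<close>.
\<close>

definition fa_space :: "(nat \<Rightarrow> nat) \<Rightarrow> (nat \<Rightarrow> nat \<Rightarrow> real \<Rightarrow> real) \<Rightarrow> ((nat \<Rightarrow> nat) \<times> real) set" where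
  "fa_space p lam = {(\<alpha>, y). \<alpha> \<in> odometer p \<and> y \<in> {0..1} \<and>
     (\<exists>z\<in>{0..1}. (\<lambda>n. lam_comp lam \<alpha> n z) \<longlonglongrightarrow> y)}"

text \<open>
  For Floyd-Auslander systems the limit defining the second coordinate exists and does not
  depend on the choice of \<open>z\<close>.
\<close>

definition fa_map ::
  "(nat \<Rightarrow> nat) \<Rightarrow> (nat \<Rightarrow> nat \<Rightarrow> real \<Rightarrow> real) \<Rightarrow> (nat \<Rightarrow> nat) \<times> real \<Rightarrow> (nat \<Rightarrow> nat) \<times> real" where
  "fa_map p lam = (\<lambda>(\<alpha>, y).
     let z = (SOME z. z \<in> {0..1} \<and> (\<lambda>n. lam_comp lam \<alpha> n z) \<longlonglongrightarrow> y);
         \<alpha>' = odo_add p \<alpha> odo_one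
     in (\<alpha>', lim (\<lambda>n. lam_comp lam \<alpha>' n z)))"

definition fa_Q :: "(nat \<Rightarrow> nat) \<Rightarrow> (nat \<Rightarrow> nat \<Rightarrow> real \<Rightarrow> real) \<Rightarrow> nat \<Rightarrow> nat set" where
  "fa_Q p lam n = {j. j < p n \<and> lam n j = lam1}"

definition floyd_auslander :: "(nat \<Rightarrow> nat) \<Rightarrow> (nat \<Rightarrow> nat \<Rightarrow> real \<Rightarrow> real) \<Rightarrow> bool" where
  "floyd_auslander p lam \<longleftrightarrow>
     (\<forall>n. p n > 1) \<and>
     (\<forall>n. \<forall>j<p n. lam n j \<in> {lam0, lam1, lam2}) \<and>
     infinite {n. lam n 0 \<in> {lam0, lam2}} \<and>
     infinite {n. lam n (p n - 1) \<in> {lam0, lam2}} \<and>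
     finite {n. fa_Q p lam n = {}}"

definition minimal_system :: "'a::topological_space set \<Rightarrow> ('a \<Rightarrow> 'a) \<Rightarrow> bool" where
  "minimal_system X T \<longleftrightarrow> (\<forall>x\<in>X. X \<subseteq> closure {(T ^^ n) x | n. True})"

text \<open>
  Self-maps of \<open>X\<close> are represented by the extensional functions \<open>X \<rightarrow>\<^sub>E X\<close>, which form the
  carrier of the product topology; composition is \<^const>\<open>compose\<close>.
\<close>

definition pointwise_top :: "'a::topological_space set \<Rightarrow> ('a \<Rightarrow> 'a) topology" where
  "pointwise_top X = product_topology (\<lambda>_. top_of_set X) X"

definition ellis :: "'a::topological_space set \<Rightarrow> ('a \<Rightarrow> 'a) \<Rightarrow> ('a \<Rightarrow> 'a) set" where
  "ellis X T = pointwise_top X closure_of {restrict (T ^^ n) X | n. n \<ge> 1}"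

definition idempotents :: "'a::topological_space set \<Rightarrow> ('a \<Rightarrow> 'a) \<Rightarrow> ('a \<Rightarrow> 'a) set" where
  "idempotents X T = {f \<in> ellis X T. compose X f f = f}"

definition idem_le :: "'a set \<Rightarrow> ('a \<Rightarrow> 'a) \<Rightarrow> ('a \<Rightarrow> 'a) \<Rightarrow> bool" where
  "idem_le X e f \<longleftrightarrow> e = compose X e f"

definition minimal_idempotents :: "'a::topological_space set \<Rightarrow> ('a \<Rightarrow> 'a) \<Rightarrow> ('a \<Rightarrow> 'a) set" where
  "minimal_idempotents X T =
     {f \<in> idempotents X T. \<forall>e\<in>idempotents X T. idem_le X e f \<longrightarrow> idem_le X f e}"

text \<open>
  The Stone-Cech compactification of the discrete space \<open>\<nat>\<close>, as the space of all ultrafilters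
  on \<open>\<nat>\<close>, the sets of all ultrafilters containing a given \<open>A \<subseteq> \<nat>\<close> being a basis.
\<close>

definition nat_ultrafilters :: "nat filter set" where
  "nat_ultrafilters = {U. U \<noteq> bot \<and>
     (\<forall>A. eventually (\<lambda>n. n \<in> A) U \<or> eventually (\<lambda>n. n \<notin> A) U)}"

definition beta_nat :: "nat filter topology" where
  "beta_nat = topology_generated_by
     {{U \<in> nat_ultrafilters. eventually (\<lambda>n. n \<in> A) U} | A. True}"

definition nontame :: "'a::topological_space set \<Rightarrow> ('a \<Rightarrow> 'a) \<Rightarrow> bool" where
  "nontame X T \<longleftrightarrow>
     (\<exists>K \<subseteq> ellis X T. subtopology (pointwise_top X) K homeomorphic_space beta_nat)"

end

theory Submission
  imports Defs
begin

text \<open>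
  Over each point \<open>\<alpha>\<close> of the odometer lies a fibre, the image of the unit interval under an
  affine map \<open>L \<alpha>\<close>; it is nondegenerate iff all but finitely many of the maps \<open>lam n (\<alpha> n)\<close>
  are the identity.  In these coordinates \<open>T ^^ n\<close> sends \<open>(\<alpha>, L \<alpha> z)\<close> to \<open>(\<alpha> + n, L (\<alpha> + n) z)\<close>
  (\<open>fa_map_iter\<close>).  An element of the Ellis semigroup is a pointwise limit of iterates
  (\<open>ellis_iff_limit\<close>): it translates the odometer and is affine on fibres.

  If only finitely many sets \<open>fa_Q p lam n\<close> have two elements, then the sequences \<open>\<alpha>\<close> with
  nondegenerate fibre all have the same tail, so there are countably many of them.  An element of
  the Ellis semigroup is then determined by its translation and by countably many real numbers, and
  the semigroup has at most the cardinality of the continuum (\<open>ellis_small\<close>).  It has neither too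
  many minimal idempotents nor a copy of the Stone-Cech compactification of \<open>\<nat>\<close>, because there are
  more ultrafilters than real numbers (\<open>many_ultrafilters\<close>).

  If infinitely many of these sets have two elements, let \<open>high\<close> consist of the largest digits
  in these sets, and for a set \<open>B\<close> of such positions let \<open>switch B\<close> have the least digits at the
  positions in \<open>B\<close> instead.  There is a number, \<open>step k\<close>, whose addition changes the least digit
  at position \<open>k\<close> into the largest.  If \<open>k \<in> B\<close>, adding it leaves the maps equal to the
  identity from a fixed position on, and nothing moves in the fibre coordinate.  If \<open>k \<notin> B\<close>, a digit beyond the largest one is
  produced, perhaps after some carries, and a contraction appears.  Along a sparse sequence of
  positions these carries do not reach each other, and the contraction is always towards the same
  end; the opposite endpoint \<open>\<zeta>\<close> of the interval corresponds to a point of the fibre that stays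
  put if \<open>k \<in> B\<close> and otherwise moves by at least half the length of the fibre.  As \<open>B\<close> is an
  arbitrary set of terms of this sequence, the iterates \<open>T ^^ step k\<close> for these \<open>k\<close> are
  independent, and their closure is a copy of the space of ultrafilters
  (\<open>nontame_if_separated\<close>, \<open>nontame_large\<close>).

  For the minimal idempotents, an element of the Ellis semigroup that preserves every fibre and
  collapses it to a point is a minimal idempotent (\<open>minimal_idempotentI\<close>).  Minimality of the system
  provides infinitely many contractions towards \<open>\<zeta>\<close> (\<open>minimal_infinite_contraction\<close>).  For a
  family of continuum many independent sets \<open>B\<close>, and any subfamily, a step, followed by
  contractions towards \<open>\<zeta>\<close>, followed by further contractions of finitely many given fibres, yields
  iterates that bring the fibres over \<open>switch B\<close> close to the end given by \<open>\<zeta>\<close> exactly for \<open>B\<close>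
  in the subfamily (\<open>simultaneous_approximation\<close>).  Their limits along an ultrafilter are minimal
  idempotents, different for different subfamilies.
\<close>

section \<open>Ultrafilters on the natural numbers\<close>

lemma nat_ultrafilters_iff:
  assumes "U \<in> nat_ultrafilters"
  shows "eventually (\<lambda>n. \<not> P n) U \<longleftrightarrow> \<not> eventually P U"
proof -
  have "U \<noteq> bot" and dich: "\<And>A. eventually (\<lambda>n. n \<in> A) U \<or> eventually (\<lambda>n. n \<notin> A) U"
    using assms by (auto simp: nat_ultrafilters_def)
  have "\<not> (eventually P U \<and> eventually (\<lambda>n. \<not> P n) U)"
    using \<open>U \<noteq> bot\<close> eventually_conj[of P U "\<lambda>n. \<not> P n"] by (auto simp: trivial_limit_def)
  then show ?thesis using dich[of "{n. P n}"] by auto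
qed

lemma ultrafilter_below:
  assumes "F \<noteq> bot"
  shows "\<exists>U\<in>nat_ultrafilters. U \<le> F"
proof -
  define \<A> where "\<A> = {G. G \<noteq> bot \<and> G \<le> F}"
  let ?r = "{(G, H). G \<in> \<A> \<and> H \<in> \<A> \<and> H \<le> G}"
  have fld: "Field ?r = \<A>" by (auto simp: Field_def)
  have "refl_on \<A> ?r" by (auto simp: refl_on_def)
  moreover have "trans ?r" by (rule transI) auto
  moreover have "antisym ?r" by (rule antisymI) auto
  moreover have "?r \<subseteq> \<A> \<times> \<A>" by auto
  ultimately have po: "Partial_order ?r"
    unfolding fld partial_order_on_def preorder_on_def by simp
  have chains: "\<exists>u\<in>Field ?r. \<forall>a\<in>C. (a, u) \<in> ?r" if C: "C \<in> Chains ?r" for C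
  proof (cases "C = {}")
    case True
    moreover have "F \<in> \<A>" using assms by (simp add: \<A>_def)
    ultimately show ?thesis unfolding fld by blast
  next
    case False
    have CA: "C \<subseteq> \<A>" using C by (auto simp: Chains_def)
    have "Inf C \<noteq> bot"
    proof
      assume "Inf C = bot"
      then have "eventually (\<lambda>_. False) (Inf C)" by simp
      moreover have "\<exists>x\<in>C. x \<le> inf G H" if "G \<in> C" "H \<in> C" for G H
      proof -
        have "G \<le> H \<or> H \<le> G" using C that by (auto simp: Chains_def)
        then show ?thesis using that by (metis inf.orderE inf_commute order_refl)
      qed
      ultimately obtain b where "b \<in> C" "eventually (\<lambda>_. False) b"
        using eventually_Inf_base[OF False] by blast
      then show False using CA by (auto simp: \<A>_def trivial_limit_def)
    qed
    moreover obtain G where "G \<in> C" "G \<le> F" using False CA by (auto simp: \<A>_def)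
    then have "Inf C \<le> F" by (meson Inf_lower order_trans)
    ultimately have "Inf C \<in> \<A>" by (simp add: \<A>_def)
    moreover have "\<forall>a\<in>C. (a, Inf C) \<in> ?r"
      using CA \<open>Inf C \<in> \<A>\<close> by (blast intro: Inf_lower)
    ultimately show ?thesis unfolding fld by blast
  qed
  obtain U where U: "U \<in> \<A>" "\<And>G. G \<in> \<A> \<Longrightarrow> G \<le> U \<Longrightarrow> G = U"
    using Zorns_po_lemma[OF po chains] unfolding fld by blast
  have "eventually (\<lambda>n. n \<in> A) U \<or> eventually (\<lambda>n. n \<notin> A) U" for A
  proof (cases "inf U (principal A) = bot")
    case True
    then show ?thesis by (simp add: trivial_limit_def eventually_inf_principal)
  next
    case False
    moreover have "inf U (principal A) \<le> F" using U(1) by (simp add: \<A>_def le_infI1)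
    ultimately have "inf U (principal A) = U" by (intro U(2)) (auto simp: \<A>_def)
    moreover have "eventually (\<lambda>n. n \<in> A) (inf U (principal A))"
      by (simp add: eventually_inf_principal)
    ultimately show ?thesis by simp
  qed
  then show ?thesis using U by (auto simp: nat_ultrafilters_def \<A>_def)
qed

text \<open>A downward directed family of nonempty sets is contained in an ultrafilter.\<close>

lemma ultrafilter_of_base:
  fixes \<C> :: "nat set set"
  assumes ne: "\<C> \<noteq> {}" "{} \<notin> \<C>"
    and dir: "\<And>A B. A \<in> \<C> \<Longrightarrow> B \<in> \<C> \<Longrightarrow> \<exists>D\<in>\<C>. D \<subseteq> A \<inter> B"
  shows "\<exists>U\<in>nat_ultrafilters. \<forall>C\<in>\<C>. eventually (\<lambda>n. n \<in> C) U"
proof -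
  let ?F = "INF C\<in>\<C>. principal C"
  have base: "eventually P ?F \<longleftrightarrow> (\<exists>C\<in>\<C>. eventually P (principal C))" for P
    by (rule eventually_INF_base) (use ne dir in auto)
  have "?F \<noteq> bot"
  proof
    assume "?F = bot"
    then have "eventually (\<lambda>_. False) ?F" by simp
    then show False unfolding base using ne by (auto simp: eventually_principal)
  qed
  then obtain U where U: "U \<in> nat_ultrafilters" "U \<le> ?F" using ultrafilter_below by blast
  have "eventually (\<lambda>n. n \<in> C) U" if "C \<in> \<C>" for C
    using U(2) that unfolding le_filter_def base by (auto simp: eventually_principal)
  with U(1) show ?thesis by blast
qed

lemma ultrafilter_compact_limit:
  fixes x :: "nat \<Rightarrow> 'a::topological_space"
  assumes "compact K" "U \<in> nat_ultrafilters" "eventually (\<lambda>i. x i \<in> K) U"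
  shows "\<exists>l\<in>K. (x \<longlongrightarrow> l) U"
proof -
  have "U \<noteq> bot" using assms by (auto simp: nat_ultrafilters_def)
  then have "filtermap x U \<noteq> bot" by (simp add: filtermap_bot_iff)
  moreover have "eventually (\<lambda>y. y \<in> K) (filtermap x U)" using assms by (simp add: eventually_filtermap)
  ultimately obtain l where l: "l \<in> K" "inf (nhds l) (filtermap x U) \<noteq> bot"
    using assms(1) unfolding compact_filter by blast
  have "(x \<longlongrightarrow> l) U"
  proof (rule topological_tendstoI)
    fix S assume S: "open S" "l \<in> S"
    show "eventually (\<lambda>i. x i \<in> S) U"
    proof (rule ccontr)
      assume "\<not> ?thesis"
      then have "eventually (\<lambda>i. x i \<notin> S) U" using nat_ultrafilters_iff[OF assms(2)] by blast
      then have "eventually (\<lambda>y. False) (inf (nhds l) (filtermap x U))"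
        unfolding eventually_inf eventually_filtermap
        using eventually_nhds_in_open[OF S] by (intro exI[of _ "\<lambda>y. y \<in> S"] exI[of _ "\<lambda>y. y \<notin> S"]) auto
      with l show False by (simp add: trivial_limit_def)
    qed
  qed
  with l show ?thesis by blast
qed

text \<open>
  An independent family of continuum many sets, after Fichtenholz, Kantorovich and Hausdorff:
  the index \<open>(N, ls)\<close> belongs to the set of \<open>x\<close> iff the initial segment of length \<open>N\<close> of the
  characteristic function of \<open>x\<close> is listed in \<open>ls\<close>.
\<close>

definition indep :: "nat set \<Rightarrow> nat set" where
  "indep x = {i. case from_nat i of (N :: nat, ls :: bool list list) \<Rightarrow>
      map (\<lambda>n. n \<in> x) [0..<N] \<in> set ls}"

text \<open>
  Once \<open>N\<close> is so large that the initial segments of length \<open>N\<close> distinguish the members of \<open>\<Phi>\<close>, the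
  list of the segments of those in \<open>S\<close> gives the required index.
\<close>

lemma indep_pattern:
  assumes "finite \<Phi>"
  shows "\<exists>i\<ge>m. \<forall>x\<in>\<Phi>. i \<in> indep x \<longleftrightarrow> x \<in> S"
proof -
  let ?seg = "\<lambda>N (x::nat set). map (\<lambda>n. n \<in> x) [0..<N]"
  have ex: "\<exists>d. \<forall>N\<ge>d. ?seg N x \<noteq> ?seg N y" if "x \<noteq> y" for x y :: "nat set"
  proof -
    obtain d where "(d \<in> x) \<noteq> (d \<in> y)" using \<open>x \<noteq> y\<close> by blast
    then have "\<forall>N\<ge>Suc d. ?seg N x \<noteq> ?seg N y" by (auto simp: map_eq_conv Suc_le_eq)
    then show ?thesis by blast
  qed
  then obtain d where d: "\<And>x y N. x \<noteq> y \<Longrightarrow> N \<ge> d x y \<Longrightarrow> ?seg N x \<noteq> ?seg N y" by metis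
  define N0 where "N0 = Max (insert 0 ((\<lambda>(x, y). d x y) ` (\<Phi> \<times> \<Phi>)))"
  have N0: "d x y \<le> N0" if "x \<in> \<Phi>" "y \<in> \<Phi>" for x y
    unfolding N0_def using assms that by (intro Max_ge) auto
  have "\<exists>ls. set ls = ?seg N ` (\<Phi> \<inter> S)" for N
    using assms by (intro finite_list) simp
  then obtain ls where set: "\<And>N. set (ls N) = ?seg N ` (\<Phi> \<inter> S)" by metis
  define idx where "idx N = to_nat (N, ls N)" for N
  have good: "idx N \<in> indep x \<longleftrightarrow> x \<in> S" if N: "N \<ge> N0" and x: "x \<in> \<Phi>" for N x
  proof -
    have "idx N \<in> indep x \<longleftrightarrow> ?seg N x \<in> ?seg N ` (\<Phi> \<inter> S)"
      by (simp add: indep_def idx_def set del: map_eq_conv)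
    also have "\<dots> \<longleftrightarrow> x \<in> S"
    proof
      assume "?seg N x \<in> ?seg N ` (\<Phi> \<inter> S)"
      then obtain y where y: "y \<in> \<Phi> \<inter> S" "?seg N x = ?seg N y" by blast
      have "x = y"
      proof (rule ccontr)
        assume "x \<noteq> y"
        with y N0[OF x, of y] N d[of x y N] show False by simp
      qed
      with y show "x \<in> S" by simp
    qed (use x in blast)
    finally show ?thesis .
  qed
  have "inj idx" by (auto simp: idx_def inj_def)
  then have "infinite (idx ` {N0..})"
    using finite_imageD[of idx "{N0..}"] infinite_Ici inj_on_subset by blast
  then obtain i where "i \<in> idx ` {N0..}" "i \<ge> m" by (meson infinite_nat_iff_unbounded_le)
  then show ?thesis using good by auto
qed

lemma many_ultrafilters: "(UNIV :: nat set set set) \<lesssim> nat_ultrafilters"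
proof -
  have "\<exists>U\<in>nat_ultrafilters. \<forall>x. eventually (\<lambda>i. i \<in> indep x \<longleftrightarrow> x \<in> S) U" for S
  proof -
    define C where "C \<Phi> = {i. \<forall>x\<in>\<Phi>. i \<in> indep x \<longleftrightarrow> x \<in> S}" for \<Phi>
    have "\<exists>U\<in>nat_ultrafilters. \<forall>D\<in>C ` Collect finite. eventually (\<lambda>n. n \<in> D) U"
    proof (rule ultrafilter_of_base)
      show "{} \<notin> C ` Collect finite" using indep_pattern unfolding C_def by blast
      fix A B assume "A \<in> C ` Collect finite" "B \<in> C ` Collect finite"
      then obtain \<Phi> \<Psi> where *: "finite \<Phi>" "finite \<Psi>" "A = C \<Phi>" "B = C \<Psi>" by auto
      show "\<exists>D\<in>C ` Collect finite. D \<subseteq> A \<inter> B"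
        by (rule bexI[of _ "C (\<Phi> \<union> \<Psi>)"]) (use * in \<open>auto simp: C_def\<close>)
    qed auto
    then obtain U where U: "U \<in> nat_ultrafilters"
      "\<And>\<Phi>. finite \<Phi> \<Longrightarrow> eventually (\<lambda>n. n \<in> C \<Phi>) U" by auto
    have "eventually (\<lambda>i. i \<in> indep x \<longleftrightarrow> x \<in> S) U" for x
      using U(2)[of "{x}"] by (simp add: C_def)
    with U(1) show ?thesis by blast
  qed
  then obtain u where u: "\<And>S. u S \<in> nat_ultrafilters"
    "\<And>S x. eventually (\<lambda>i. i \<in> indep x \<longleftrightarrow> x \<in> S) (u S)" by metis
  have "inj u"
  proof (rule injI)
    fix S S' assume eq: "u S = u S'"
    have "x \<in> S \<longleftrightarrow> x \<in> S'" for x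
    proof -
      have "eventually (\<lambda>i. x \<in> S \<longleftrightarrow> x \<in> S') (u S)"
        using u(2)[of x S] u(2)[of x S'] unfolding eq by eventually_elim auto
      then show ?thesis
        using u(1)[of S] nat_ultrafilters_iff[OF u(1), of "\<lambda>_. False"]
        by (cases "x \<in> S \<longleftrightarrow> x \<in> S'") auto
    qed
    then show "S = S'" by blast
  qed
  with u(1) show ?thesis by (auto simp: lepoll_def)
qed

section \<open>Ellis semigroups and pointwise limits\<close>

lemma topspace_pointwise_top [simp]: "topspace (pointwise_top X) = X \<rightarrow>\<^sub>E X"
  by (simp add: pointwise_top_def)

lemma ellis_subset: "ellis X T \<subseteq> X \<rightarrow>\<^sub>E X"
  using closure_of_subset_topspace[of "pointwise_top X"] by (simp add: ellis_def)

lemma funpow_maps_into: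
  assumes "T \<in> X \<rightarrow> X" "x \<in> X"
  shows "(T ^^ n) x \<in> X"
  using assms by (induction n) auto

lemma limitin_pointwise_top:
  assumes T: "T \<in> X \<rightarrow> X"
  shows "limitin (pointwise_top X) (\<lambda>i. restrict (T ^^ n i) X) f G \<longleftrightarrow>
    f \<in> X \<rightarrow>\<^sub>E X \<and> (\<forall>x\<in>X. ((\<lambda>i. (T ^^ n i) x) \<longlongrightarrow> f x) G)"
  unfolding pointwise_top_def limitin_componentwise
  using funpow_maps_into[OF T]
  by (auto simp: limitin_subtopology PiE_iff extensional_def)

text \<open>The elements of the Ellis semigroup are the pointwise limits of iterates along filters.\<close>

lemma ellis_iff_limit:
  assumes T: "T \<in> X \<rightarrow> X"
  shows "f \<in> ellis X T \<longleftrightarrow> f \<in> X \<rightarrow>\<^sub>E X \<and> (\<exists>G. G \<noteq> bot \<and> eventually (\<lambda>n. n \<ge> 1) G \<and>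
           (\<forall>x\<in>X. ((\<lambda>n. (T ^^ n) x) \<longlongrightarrow> f x) G))" (is "_ \<longleftrightarrow> _ \<and> ?R")
proof
  let ?g = "\<lambda>n. restrict (T ^^ n) X"
  assume f: "f \<in> ellis X T"
  then have fX: "f \<in> X \<rightarrow>\<^sub>E X" using ellis_subset by blast
  define G where "G = inf (filtercomap ?g (nhdsin (pointwise_top X) f)) (principal {1..})"
  have G_ev: "eventually P G" 
    if "openin (pointwise_top X) S" "f \<in> S" "\<And>n. n \<ge> 1 \<Longrightarrow> ?g n \<in> S \<Longrightarrow> P n" for P S
  proof -
    have "eventually (\<lambda>h. h \<in> S) (nhdsin (pointwise_top X) f)"
      using that by (auto simp: eventually_nhdsin)
    then show ?thesis unfolding G_def eventually_inf_principal eventually_filtercomap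
      using that(3) by (intro exI[of _ "\<lambda>h. h \<in> S"]) auto
  qed
  have "G \<noteq> bot"
  proof
    assume "G = bot"
    then have "eventually (\<lambda>_. False) G" by simp
    then obtain Q where Q: "eventually Q (nhdsin (pointwise_top X) f)" "\<And>n. n \<ge> 1 \<Longrightarrow> \<not> Q (?g n)"
      unfolding G_def eventually_inf_principal eventually_filtercomap by auto
    then obtain S where "openin (pointwise_top X) S" "f \<in> S" "\<And>h. h \<in> S \<Longrightarrow> Q h"
      using fX by (auto simp: eventually_nhdsin)
    then show False using f Q(2) unfolding ellis_def in_closure_of by blast
  qed
  moreover have "eventually (\<lambda>n. n \<ge> 1) G" by (simp add: G_def eventually_inf_principal)
  moreover have "limitin (pointwise_top X) ?g f G"
    unfolding limitin_def using fX by (auto intro: G_ev)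
  then have "\<forall>x\<in>X. ((\<lambda>n. (T ^^ n) x) \<longlongrightarrow> f x) G"
    using limitin_pointwise_top[OF T, where n = "\<lambda>n. n"] by simp
  ultimately show "f \<in> X \<rightarrow>\<^sub>E X \<and> ?R" using fX by blast
next
  assume R: "f \<in> X \<rightarrow>\<^sub>E X \<and> ?R"
  then obtain G where G: "G \<noteq> bot" "eventually (\<lambda>n. n \<ge> 1) G"
    "limitin (pointwise_top X) (\<lambda>n. restrict (T ^^ n) X) f G"
    using limitin_pointwise_top[OF T, where n = "\<lambda>n. n"] by auto
  show "f \<in> ellis X T" unfolding ellis_def in_closure_of
  proof (intro conjI allI impI)
    fix S assume S: "f \<in> S \<and> openin (pointwise_top X) S"
    then have "eventually (\<lambda>n. restrict (T ^^ n) X \<in> S) G" using G(3) by (simp add: limitin_def)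
    then obtain n where "n \<ge> 1" "restrict (T ^^ n) X \<in> S"
      using eventually_happens'[OF G(1) eventually_conj[OF G(2)]] by blast
    then show "\<exists>y. y \<in> {restrict (T ^^ n) X |n. 1 \<le> n} \<and> y \<in> S" by blast
  qed (use R in simp)
qed

lemma ellis_of_ultrafilter:
  assumes "compact X" and T: "T \<in> X \<rightarrow> X"
    and U: "U \<in> nat_ultrafilters" "eventually (\<lambda>i. n i \<ge> 1) U"
  shows "\<exists>f\<in>ellis X T. \<forall>x\<in>X. ((\<lambda>i. (T ^^ n i) x) \<longlongrightarrow> f x) U"
proof -
  have "\<exists>l\<in>X. ((\<lambda>i. (T ^^ n i) x) \<longlongrightarrow> l) U" if "x \<in> X" for x
    using ultrafilter_compact_limit[OF \<open>compact X\<close> U(1)] funpow_maps_into[OF T that]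
    by (simp add: always_eventually)
  then obtain l where l: "\<And>x. x \<in> X \<Longrightarrow> l x \<in> X"
    "\<And>x. x \<in> X \<Longrightarrow> ((\<lambda>i. (T ^^ n i) x) \<longlongrightarrow> l x) U" by metis
  have "filtermap n U \<noteq> bot" using U by (simp add: filtermap_bot_iff nat_ultrafilters_def)
  moreover have "eventually (\<lambda>n. n \<ge> 1) (filtermap n U)" using U by (simp add: eventually_filtermap)
  moreover have "\<forall>x\<in>X. ((\<lambda>n. (T ^^ n) x) \<longlongrightarrow> restrict l X x) (filtermap n U)"
    using l by (simp add: filterlim_filtermap)
  ultimately have "restrict l X \<in> ellis X T"
    unfolding ellis_iff_limit[OF T]
    by (intro conjI exI[of _ "filtermap n U"]) (use l in auto)
  with l show ?thesis by (intro bexI[of _ "restrict l X"]) auto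
qed

lemma topspace_beta_nat: "topspace beta_nat = nat_ultrafilters"
proof -
  let ?B = "{{U \<in> nat_ultrafilters. eventually (\<lambda>n. n \<in> A) U} | A. True}"
  have "{U \<in> nat_ultrafilters. eventually (\<lambda>n. n \<in> UNIV) U} \<in> ?B" by blast
  then have "nat_ultrafilters \<in> ?B" by simp
  then have "\<Union> ?B = nat_ultrafilters" by blast
  then show ?thesis by (simp add: beta_nat_def)
qed

text \<open>
  If points \<open>x A\<close> separate the limits of the iterates \<open>T ^^ n i\<close> over \<open>i \<in> A\<close> from those over
  \<open>i \<notin> A\<close>, for every \<open>A\<close>, then the closure of these iterates is a copy of the space of
  ultrafilters.
\<close>

lemma nontame_if_separated:
  fixes X :: "'a::topological_space set" and x :: "nat set \<Rightarrow> 'a"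
  assumes "regular_space (euclidean :: 'a topology)" "compact X" and T: "T \<in> X \<rightarrow> X" and n: "\<And>i. n i \<ge> 1"
    and x: "\<And>A. x A \<in> X"
    and C: "\<And>A. closed (C A)" "\<And>A. closed (D A)" "\<And>A. C A \<inter> D A = {}"
    and sep: "\<And>A i. i \<in> A \<Longrightarrow> (T ^^ n i) (x A) \<in> C A" "\<And>A i. i \<notin> A \<Longrightarrow> (T ^^ n i) (x A) \<in> D A"
  shows "nontame X T"
proof -
  let ?P = "pointwise_top X"
  obtain l where l: "\<And>U. U \<in> nat_ultrafilters \<Longrightarrow> l U \<in> ellis X T"
    "\<And>U x. U \<in> nat_ultrafilters \<Longrightarrow> x \<in> X \<Longrightarrow> ((\<lambda>i. (T ^^ n i) x) \<longlongrightarrow> l U x) U"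
    using ellis_of_ultrafilter[OF \<open>compact X\<close> T, where n = n] n by (metis always_eventually)
  define K where "K = l ` nat_ultrafilters"
  have KE: "K \<subseteq> ellis X T" using l by (auto simp: K_def)
  have KX: "K \<subseteq> X \<rightarrow>\<^sub>E X" using KE ellis_subset by blast
  note top_beta = topspace_beta_nat
  have memb: "eventually (\<lambda>i. i \<in> A) U \<longleftrightarrow> l U (x A) \<in> - D A" "eventually (\<lambda>i. i \<in> A) U \<longleftrightarrow> l U (x A) \<in> C A"
    if U: "U \<in> nat_ultrafilters" for A U
  proof -
    have nb: "U \<noteq> bot" using U by (simp add: nat_ultrafilters_def)
    have "l U (x A) \<in> C A" if "eventually (\<lambda>i. i \<in> A) U"
      by (rule Lim_in_closed_set[OF C(1) _ nb l(2)[OF U x]])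
        (use that sep(1) in \<open>auto elim: eventually_mono\<close>)
    moreover have "l U (x A) \<in> D A" if "eventually (\<lambda>i. i \<notin> A) U"
      by (rule Lim_in_closed_set[OF C(2) _ nb l(2)[OF U x]])
        (use that sep(2) in \<open>auto elim: eventually_mono\<close>)
    ultimately show "eventually (\<lambda>i. i \<in> A) U \<longleftrightarrow> l U (x A) \<in> - D A" 
      "eventually (\<lambda>i. i \<in> A) U \<longleftrightarrow> l U (x A) \<in> C A"
      using nat_ultrafilters_iff[OF U, of "\<lambda>i. i \<in> A"] C(3)[of A] by blast+
  qed
  have inj: "inj_on l nat_ultrafilters"
  proof (rule inj_onI)
    fix U V assume UV: "U \<in> nat_ultrafilters" "V \<in> nat_ultrafilters" "l U = l V"
    then have "eventually (\<lambda>i. i \<in> A) U \<longleftrightarrow> eventually (\<lambda>i. i \<in> A) V" for A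
      using memb[of U A] memb[of V A] by simp
    from this[of "Collect P" for P] show "U = V" by (simp add: filter_eq_iff)
  qed
  have cont: "continuous_map beta_nat (subtopology ?P K) l"
  proof -
    have "continuous_map beta_nat (top_of_set X) (\<lambda>U. l U y)" if y: "y \<in> X" for y
      unfolding continuous_map_in_subtopology
    proof
      show "(\<lambda>U. l U y) \<in> topspace beta_nat \<rightarrow> X"
        using l(1) ellis_subset y unfolding top_beta by (blast dest: PiE_mem)
      show "continuous_map beta_nat euclidean (\<lambda>U. l U y)"
        unfolding continuous_map_def top_beta
      proof (intro conjI allI impI)
        fix S :: "'a set" assume "openin euclidean S"
        then have "open S" by simp
        show "openin beta_nat {U \<in> nat_ultrafilters. l U y \<in> S}"
        proof (subst openin_subopen, intro ballI)
          fix U assume "U \<in> {U \<in> nat_ultrafilters. l U y \<in> S}"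
          then have U: "U \<in> nat_ultrafilters" "l U y \<in> S" by auto
          \<comment> \<open>Limits of points outside a neighbourhood \<open>W\<close> of the complement of \<open>S\<close> are in \<open>S\<close>.\<close>
          have "closedin euclidean (- S)" "l U y \<in> topspace euclidean - (- S)"
            using \<open>open S\<close> U(2) by (auto simp: closed_def)
          then have "\<exists>V W. openin euclidean V \<and> openin euclidean W \<and> l U y \<in> V \<and> - S \<subseteq> W \<and> disjnt V W"
            using assms(1) unfolding regular_space_def by simp
          then obtain V W where VW: "open V" "open W" "l U y \<in> V" "- S \<subseteq> W" "V \<inter> W = {}"
            unfolding disjnt_def open_openin[symmetric] by blast
          define A where "A = {i. (T ^^ n i) y \<in> - W}"
          let ?B = "{U \<in> nat_ultrafilters. eventually (\<lambda>i. i \<in> A) U}"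
          have "eventually (\<lambda>i. (T ^^ n i) y \<in> V) U"
            using l(2)[OF U(1) y] VW by (simp add: tendsto_def)
          then have "eventually (\<lambda>i. i \<in> A) U"
            by (rule eventually_mono) (use VW in \<open>auto simp: A_def\<close>)
          then have "U \<in> ?B" using U by simp
          moreover have "openin beta_nat ?B"
            unfolding beta_nat_def by (rule topology_generated_by_Basis) blast
          moreover have "?B \<subseteq> {U \<in> nat_ultrafilters. l U y \<in> S}"
          proof safe
            fix U' assume U': "U' \<in> nat_ultrafilters" "eventually (\<lambda>i. i \<in> A) U'"
            have "l U' y \<in> - W"
              by (rule Lim_in_closed_set[OF _ _ _ l(2)[OF U'(1) y]])
                (use U' VW in \<open>auto simp: A_def closed_def nat_ultrafilters_def\<close>)
            then show "l U' y \<in> S" using VW by blast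
          qed
          ultimately show "\<exists>B. openin beta_nat B \<and> U \<in> B \<and> B \<subseteq> {U \<in> nat_ultrafilters. l U y \<in> S}"
            by blast
        qed
      qed auto
    qed
    moreover have "l ` topspace beta_nat \<subseteq> extensional X"
      using KX unfolding top_beta K_def by (auto simp: PiE_iff)
    ultimately have "continuous_map beta_nat ?P l"
      unfolding pointwise_top_def by (subst continuous_map_componentwise) auto
    then show ?thesis by (auto simp: continuous_map_in_subtopology K_def top_beta)
  qed
  define r where "r = inv_into nat_ultrafilters l"
  have r: "r (l U) = U" if "U \<in> nat_ultrafilters" for U using that inj by (simp add: r_def)
  have topK: "topspace (subtopology ?P K) = K" using KX by (auto simp: topspace_subtopology)
  have cont': "continuous_map (subtopology ?P K) beta_nat r"
    unfolding beta_nat_def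
  proof (rule continuous_on_generated_topo)
    show "r ` topspace (subtopology ?P K) \<subseteq> \<Union> {{U \<in> nat_ultrafilters. \<forall>\<^sub>F n in U. n \<in> A} |A. True}"
      using r topspace_beta_nat unfolding topK K_def by (auto simp: beta_nat_def)
    fix B assume "B \<in> {{U \<in> nat_ultrafilters. \<forall>\<^sub>F n in U. n \<in> A} |A. True}"
    then obtain A where B: "B = {U \<in> nat_ultrafilters. \<forall>\<^sub>F n in U. n \<in> A}" by blast
    have "continuous_map ?P (top_of_set X) (\<lambda>f. f (x A))"
      unfolding pointwise_top_def using x by (rule continuous_map_product_projection)
    then have "continuous_map ?P euclidean (\<lambda>f. f (x A))"
      by (simp add: continuous_map_in_subtopology)
    then have "openin ?P {f \<in> topspace ?P. f (x A) \<in> - D A}"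
      using C(2) by (intro openin_continuous_map_preimage) (auto simp: closed_def)
    moreover have "r -` B \<inter> topspace (subtopology ?P K) = {f \<in> topspace ?P. f (x A) \<in> - D A} \<inter> K"
      unfolding topK using KX memb(1) r by (auto simp: K_def B)
    ultimately show "openin (subtopology ?P K) (r -` B \<inter> topspace (subtopology ?P K))"
      by (auto simp: openin_subtopology)
  qed
  have "homeomorphic_maps (subtopology ?P K) beta_nat r l"
    unfolding homeomorphic_maps_def topK top_beta using cont cont' r by (auto simp: K_def)
  then show ?thesis
    unfolding nontame_def homeomorphic_space_def using KE by blast
qed

text \<open>There are more ultrafilters than subsets of \<open>\<nat>\<close>, so a small Ellis semigroup is tame.\<close>

lemma nontame_not_lepoll:
  assumes "nontame X T"
  shows "\<not> ellis X T \<lesssim> (UNIV :: nat set set)"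
proof
  assume small: "ellis X T \<lesssim> (UNIV :: nat set set)"
  obtain K where K: "K \<subseteq> ellis X T" "subtopology (pointwise_top X) K homeomorphic_space beta_nat"
    using assms by (auto simp: nontame_def)
  have topK: "topspace (subtopology (pointwise_top X) K) = K"
    using K(1) ellis_subset[of X T] by (auto simp: topspace_subtopology)
  obtain f where "homeomorphic_map (subtopology (pointwise_top X) K) beta_nat f"
    using K(2) by (auto simp: homeomorphic_space)
  then have "f ` K = nat_ultrafilters"
    using homeomorphic_imp_surjective_map topK topspace_beta_nat by metis
  then have "nat_ultrafilters \<lesssim> K" using image_lepoll[of f K] by simp
  have "(UNIV :: nat set set) \<prec> Pow (UNIV :: nat set set)" by (rule lesspoll_Pow_self)
  also have "Pow (UNIV :: nat set set) \<lesssim> nat_ultrafilters" using many_ultrafilters by simp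
  also have "nat_ultrafilters \<lesssim> K" by fact
  also have "K \<lesssim> ellis X T" using K(1) by (rule subset_imp_lepoll)
  also note small
  finally show False by (simp add: lesspoll_def)
qed

section \<open>Addition of natural numbers in the odometer\<close>

text \<open>
  Digit sequences are compared through the values of their initial segments, which turns addition
  with carry into addition modulo the place values.
\<close>

locale odo =
  fixes p :: "nat \<Rightarrow> nat"
  assumes p_gt1: "p n > 1"
begin

text \<open>The place value of position \<open>n\<close>.\<close>

definition P :: "nat \<Rightarrow> nat" where "P n = (\<Prod>i<n. p i)"

text \<open>The value of the first \<open>n\<close> digits.\<close>

definition val :: "(nat \<Rightarrow> nat) \<Rightarrow> nat \<Rightarrow> nat" where "val \<alpha> n = (\<Sum>i<n. \<alpha> i * P i)"

text \<open>
  The sum of an element of the odometer and a natural number, which is identified with the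
  element having it as value of all long initial segments.
\<close>

definition shift :: "(nat \<Rightarrow> nat) \<Rightarrow> nat \<Rightarrow> nat \<Rightarrow> nat" where
  "shift \<alpha> n j = (val \<alpha> (Suc j) + n) div P j mod p j"

lemma P_0 [simp]: "P 0 = 1" and P_Suc: "P (Suc n) = p n * P n"
  by (auto simp: P_def)

lemma p_pos [simp]: "p n > 0"
  using p_gt1[of n] by simp

lemma P_pos [simp]: "P n > 0"
  by (simp add: P_def)

lemma P_dvd: "m \<le> n \<Longrightarrow> P m dvd P n"
  unfolding P_def by (rule prod_dvd_prod_subset) auto

lemma P_mono: "m \<le> n \<Longrightarrow> P m \<le> P n"
  by (simp add: P_dvd dvd_imp_le)

lemma val_0 [simp]: "val \<alpha> 0 = 0" and val_Suc: "val \<alpha> (Suc n) = val \<alpha> n + \<alpha> n * P n"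
  by (auto simp: val_def)

lemma digit_less: "\<alpha> \<in> odometer p \<Longrightarrow> \<alpha> n < p n"
  by (simp add: odometer_def)

lemma val_less:
  assumes "\<alpha> \<in> odometer p" shows "val \<alpha> n < P n"
proof (induction n)
  case (Suc n)
  have "val \<alpha> (Suc n) < P n + \<alpha> n * P n" using Suc by (simp add: val_Suc)
  also have "\<dots> = Suc (\<alpha> n) * P n" by simp
  also have "\<dots> \<le> P (Suc n)" unfolding P_Suc using digit_less[OF assms, of n] by (intro mult_right_mono) auto
  finally show ?case .
qed simp

lemma val_cong: "(\<And>i. i < n \<Longrightarrow> \<alpha> i = \<beta> i) \<Longrightarrow> val \<alpha> n = val \<beta> n"
  by (simp add: val_def)

lemma val_mod:
  assumes "\<alpha> \<in> odometer p" "m \<le> n" shows "val \<alpha> n mod P m = val \<alpha> m"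
  using \<open>m \<le> n\<close>
proof (induction n rule: dec_induct)
  case base show ?case using val_less[OF assms(1)] by simp
next
  case (step n)
  obtain k where "P n = P m * k" using P_dvd[of m n] step by blast
  then have "val \<alpha> (Suc n) = val \<alpha> n + P m * (\<alpha> n * k)" by (simp add: val_Suc)
  then show ?case using step by simp
qed

lemma val_digit:
  assumes "\<alpha> \<in> odometer p" "j < n" shows "val \<alpha> n div P j mod p j = \<alpha> j"
proof -
  have "val \<alpha> n div P j mod p j = val \<alpha> n mod P (Suc j) div P j"
    by (simp add: P_Suc mod_mult2_eq mult.commute[of "p j"])
  also have "\<dots> = \<alpha> j" using assms val_less[OF assms(1), of j] by (simp add: val_mod val_Suc)
  finally show ?thesis .
qed

lemma val_eqD:
  assumes "\<alpha> \<in> odometer p" "\<beta> \<in> odometer p" "val \<alpha> n = val \<beta> n" "j < n"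
  shows "\<alpha> j = \<beta> j"
  using assms val_digit by metis

lemma odometer_eqI:
  assumes "\<alpha> \<in> odometer p" "\<beta> \<in> odometer p" "\<And>n. val \<alpha> n = val \<beta> n"
  shows "\<alpha> = \<beta>"
  using val_eqD[OF assms(1,2) assms(3)] by blast

lemma shift_in_odometer [simp]: "shift \<alpha> n \<in> odometer p"
  by (simp add: odometer_def shift_def)

lemma val_shift: "val (shift \<alpha> n) m = (val \<alpha> m + n) mod P m"
proof (induction m)
  case (Suc m)
  let ?x = "val \<alpha> (Suc m) + n"
  have "val \<alpha> m + n + \<alpha> m * P m = ?x" by (simp add: val_Suc)
  then have "(val \<alpha> m + n) mod P m = ?x mod P m" by (metis mod_mult_self1)
  moreover have "?x mod P (Suc m) = P m * (?x div P m mod p m) + ?x mod P m"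
    unfolding P_Suc mult.commute[of "p m"] by (rule mod_mult2_eq)
  moreover have "shift \<alpha> n m = ?x div P m mod p m" by (simp add: shift_def)
  ultimately show ?case using Suc by (simp add: val_Suc[of "shift \<alpha> n"] mult.commute)
qed simp

lemma shift_plus: "shift (shift \<alpha> m) n = shift \<alpha> (m + n)"
  by (rule odometer_eqI) (auto simp: val_shift mod_add_left_eq add.assoc)

lemma shift_0: "\<alpha> \<in> odometer p \<Longrightarrow> shift \<alpha> 0 = \<alpha>"
  by (rule odometer_eqI) (auto simp: val_shift val_less)

lemma odo_add_one:
  assumes "\<alpha> \<in> odometer p" shows "odo_add p \<alpha> odo_one = shift \<alpha> 1"
proof
  have carry: "odo_one j + odo_carry p \<alpha> odo_one j = (val \<alpha> j + 1) div P j" for j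
  proof (induction j)
    case 0 show ?case by (simp add: odo_one_def)
  next
    case (Suc j)
    have "(val \<alpha> (Suc j) + 1) div P (Suc j) = (val \<alpha> j + 1 + \<alpha> j * P j) div P j div p j"
      by (simp add: val_Suc P_Suc div_mult2_eq mult.commute[of "p j"] add.commute add.left_commute)
    also have "\<dots> = (\<alpha> j + (odo_one j + odo_carry p \<alpha> odo_one j)) div p j"
      unfolding Suc by (simp only: div_mult_self1 P_pos[THEN less_imp_neq, symmetric] add.commute not_False_eq_True)
    finally show ?case by (simp add: odo_one_def[of "Suc j"] add.assoc)
  qed
  fix j
  have "shift \<alpha> 1 j = (val \<alpha> j + 1 + \<alpha> j * P j) div P j mod p j"
    by (simp add: shift_def val_Suc add.commute add.left_commute)
  also have "\<dots> = (\<alpha> j + (odo_one j + odo_carry p \<alpha> odo_one j)) mod p j"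
    unfolding carry by (simp only: div_mult_self1 P_pos[THEN less_imp_neq, symmetric] add.commute not_False_eq_True)
  finally show "odo_add p \<alpha> odo_one j = shift \<alpha> 1 j" by (simp add: odo_add_def add.assoc)
qed

lemma shift_low:
  assumes "\<alpha> \<in> odometer p" "P k dvd n" "j < k" shows "shift \<alpha> n j = \<alpha> j"
proof (rule val_eqD[of "shift \<alpha> n" \<alpha> k])
  show "val (shift \<alpha> n) k = val \<alpha> k" using assms val_less[OF assms(1), of k]
    by (auto simp: val_shift elim!: dvdE)
qed (use assms in auto)

text \<open>Adding a multiple of \<open>P k\<close>, the carries depend only on the digits from position \<open>k\<close> on.\<close>

lemma val_split:
  assumes "k \<le> n" shows "val \<alpha> n = val \<alpha> k + P k * (\<Sum>i\<in>{k..<n}. \<alpha> i * (P i div P k))"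
proof -
  have "val \<alpha> n = val \<alpha> k + (\<Sum>i\<in>{k..<n}. \<alpha> i * P i)"
    unfolding val_def lessThan_atLeast0
    using sum.atLeastLessThan_concat[of 0 k n "\<lambda>i. \<alpha> i * P i"] assms by simp
  also have "(\<Sum>i\<in>{k..<n}. \<alpha> i * P i) = (\<Sum>i\<in>{k..<n}. P k * (\<alpha> i * (P i div P k)))"
    using P_dvd by (intro sum.cong refl) auto
  finally show ?thesis by (simp add: sum_distrib_left)
qed

lemma shift_tail_cong:
  assumes "\<alpha> \<in> odometer p" "\<beta> \<in> odometer p" "P k dvd n" "k \<le> j"
    and eq: "\<And>i. k \<le> i \<Longrightarrow> i \<le> j \<Longrightarrow> \<alpha> i = \<beta> i"
  shows "shift \<alpha> n j = shift \<beta> n j"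
proof -
  obtain m where m: "n = P k * m" using assms(3) by blast
  obtain q where q: "P j = P k * q" using P_dvd[OF \<open>k \<le> j\<close>] by blast
  have *: "(val \<gamma> (Suc j) + n) div P j = ((\<Sum>i\<in>{k..<Suc j}. \<gamma> i * (P i div P k)) + m) div q"
    if "\<gamma> \<in> odometer p" for \<gamma>
  proof -
    have "val \<gamma> (Suc j) + n = val \<gamma> k + P k * ((\<Sum>i\<in>{k..<Suc j}. \<gamma> i * (P i div P k)) + m)"
      using val_split[of k "Suc j" \<gamma>] \<open>k \<le> j\<close> m by (simp add: algebra_simps)
    then show ?thesis using val_less[OF that, of k] by (simp add: q div_mult2_eq)
  qed
  have "(\<Sum>i\<in>{k..<Suc j}. \<alpha> i * (P i div P k)) = (\<Sum>i\<in>{k..<Suc j}. \<beta> i * (P i div P k))"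
    using eq by (intro sum.cong) auto
  then show ?thesis unfolding shift_def using *[OF assms(1)] *[OF assms(2)] by simp
qed

text \<open>
  The number is the difference between the values of the first \<open>e\<close> digits of \<open>w\<close> and \<open>\<alpha>\<close>, to
  which \<open>P e\<close> is added to make it positive.
\<close>

lemma shift_steer:
  assumes "\<alpha> \<in> odometer p" "w \<in> odometer p" "c \<le> e" "\<And>i. i < c \<Longrightarrow> w i = \<alpha> i"
  shows "\<exists>n\<ge>1. P c dvd n \<and> (\<forall>j<e. shift \<alpha> n j = w j)"
proof -
  define n where "n = P e + val w e - val \<alpha> e"
  have lt: "val \<alpha> e < P e" using val_less assms by blast
  have n: "val \<alpha> e + n = P e + val w e" using lt by (simp add: n_def)
  have "val (shift \<alpha> n) e = val w e" using val_less[OF assms(2), of e] by (simp add: val_shift n)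
  then have "\<forall>j<e. shift \<alpha> n j = w j" using val_eqD[OF shift_in_odometer assms(2)] by blast
  moreover have "P c dvd n"
  proof -
    have "(val \<alpha> e + n) mod P c = val \<alpha> e mod P c"
      using val_mod[OF assms(1,3)] val_mod[OF assms(2,3)] P_dvd[OF \<open>c \<le> e\<close>] val_cong[of c w \<alpha>] assms(4)
      unfolding n by (auto elim!: dvdE)
    then have "P c dvd (val \<alpha> e + n) - val \<alpha> e" by (metis mod_eq_dvd_iff_nat le_add1)
    then show ?thesis by simp
  qed
  moreover have "n \<ge> 1" using lt by (simp add: n_def)
  ultimately show ?thesis by blast
qed

lemma shift_digit:
  assumes "\<alpha> \<in> odometer p" "\<alpha> k + d < p k"
  shows "shift \<alpha> (d * P k) = \<alpha>(k := \<alpha> k + d)"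
proof (rule odometer_eqI)
  define \<beta> where "\<beta> = \<alpha>(k := \<alpha> k + d)"
  have \<beta>: "\<beta> k = \<alpha> k + d" "\<And>i. i \<noteq> k \<Longrightarrow> \<beta> i = \<alpha> i" by (auto simp: \<beta>_def)
  show upd: "\<alpha>(k := \<alpha> k + d) \<in> odometer p" using assms by (auto simp: odometer_def)
  fix n
  have low: "val \<beta> m = val \<alpha> m" if "m \<le> k" for m
    using that by (intro val_cong) (auto simp: \<beta>)
  have "val (shift \<alpha> (d * P k)) n = val \<beta> n"
  proof (cases "k < n")
    case True
    have "val \<beta> n = val \<alpha> n + d * P k"
      using True
    proof (induction n)
      case (Suc n)
      show ?case
      proof (cases "k = n")
        case True
        then have "\<beta> n = \<alpha> n + d" "val \<beta> n = val \<alpha> n" using \<beta>(1) low by auto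
        then show ?thesis using True by (simp add: val_Suc algebra_simps)
      next
        case False
        then show ?thesis using Suc \<beta>(2)[of n] by (simp add: val_Suc)
      qed
    qed simp
    then show ?thesis using val_less[OF upd, of n] by (simp add: val_shift flip: \<beta>_def)
  next
    case False
    obtain q where "P k = P n * q" using P_dvd[of n k] False by auto
    then have dP: "d * P k = P n * (d * q)" by simp
    show ?thesis unfolding val_shift dP using val_less[OF assms(1), of n] False low[of n] by simp
  qed
  then show "val (shift \<alpha> (d * P k)) n = val (\<alpha>(k := \<alpha> k + d)) n" by (simp add: \<beta>_def)
qed simp

lemma shift_one_tail:
  assumes "\<alpha> \<in> odometer p"
  shows "(\<exists>m. \<forall>j\<ge>m. shift \<alpha> 1 j = \<alpha> j) \<or> shift \<alpha> 1 = (\<lambda>_. 0)"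
proof (cases "\<exists>m. \<alpha> m + 1 < p m")
  case True
  then obtain m where m: "\<alpha> m + 1 < p m" by blast
  let ?k = "Suc m"
  have "val \<alpha> ?k + 1 < P ?k"
  proof -
    have "val \<alpha> ?k + 1 \<le> (\<alpha> m + 1) * P m"
      using val_less[OF assms, of m] by (simp add: val_Suc)
    also have "\<dots> < P ?k" unfolding P_Suc using m by (intro mult_strict_right_mono) auto
    finally show ?thesis .
  qed
  then have *: "(val \<alpha> ?k + 1) div P ?k = 0" by simp
  have "shift \<alpha> 1 j = \<alpha> j" if j: "j \<ge> ?k" for j
  proof -
    obtain q where q: "P j = P ?k * q" using P_dvd[OF j] by blast
    define r where "r = (\<Sum>i\<in>{?k..<Suc j}. \<alpha> i * (P i div P ?k))"
    have v: "val \<alpha> (Suc j) = val \<alpha> ?k + P ?k * r" using val_split[of ?k "Suc j" \<alpha>] j by (simp add: r_def)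
    have "(val \<alpha> (Suc j) + 1) div P ?k = r"
    proof -
      have "val \<alpha> ?k + P ?k * r + 1 = (val \<alpha> ?k + 1) + P ?k * r" by simp
      then show ?thesis unfolding v using * by (simp only: div_mult_self2 P_pos less_numeral_extra(3) neq0_conv add_0_right)
    qed
    moreover have "val \<alpha> (Suc j) div P ?k = r" unfolding v using val_less[OF assms, of ?k] by simp
    ultimately have "shift \<alpha> 1 j = val \<alpha> (Suc j) div P j mod p j" by (simp add: shift_def q div_mult2_eq)
    then show ?thesis using val_digit[OF assms, of j "Suc j"] by simp
  qed
  then show ?thesis by blast
next
  case False
  then have max: "Suc (\<alpha> m) = p m" for m using digit_less[OF assms, of m] by (metis Suc_eq_plus1 Suc_lessI)
  have v: "val \<alpha> m + 1 = P m" for m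
  proof (induction m)
    case (Suc m) 
    then have "val \<alpha> (Suc m) + 1 = Suc (\<alpha> m) * P m" by (simp add: val_Suc)
    then show ?case by (simp add: max P_Suc)
  qed simp
  have "shift \<alpha> 1 = (\<lambda>_. 0)"
  proof (rule odometer_eqI)
    fix n show "val (shift \<alpha> 1) n = val (\<lambda>_. 0) n" unfolding val_shift v by (simp add: val_def)
    show "shift \<alpha> 1 \<in> odometer p" by (rule shift_in_odometer)
  qed (simp add: odometer_def)
  then show ?thesis by blast
qed

end

section \<open>The fibres of a Floyd-Auslander system\<close>

text \<open>\<open>lamh 0\<close> and \<open>lamh 1\<close> are the two contractions, the parameter being the fixed point.\<close>

definition lamh :: "real \<Rightarrow> real \<Rightarrow> real" where "lamh \<zeta> x = (x + \<zeta>) / 2"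

lemma lam0_eq: "lam0 = lamh 0" and lam2_eq: "lam2 = lamh 1"
  by (auto simp: lam0_def lam2_def lamh_def field_simps)

lemma lamh_neq_lam1: "lamh \<zeta> \<noteq> lam1"
proof
  assume "lamh \<zeta> = lam1"
  then have "lamh \<zeta> (\<zeta> + 1) = lam1 (\<zeta> + 1)" by simp
  then show False by (simp add: lamh_def lam1_def field_simps)
qed

lemma open_cylinder: "open {\<delta> :: nat \<Rightarrow> nat. \<forall>i<N. \<delta> i = \<alpha> i}"
proof -
  have "{\<delta> :: nat \<Rightarrow> nat. \<forall>i<N. \<delta> i = \<alpha> i} = (\<Inter>i\<in>{..<N}. (\<lambda>\<delta>. \<delta> i) -` {\<alpha> i})" by auto
  moreover have "open ((\<lambda>\<delta> :: nat \<Rightarrow> nat. \<delta> i) -` {\<alpha> i})" for i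
    by (intro open_vimage open_discrete continuous_on_product_coordinates)
  ultimately show ?thesis by (simp add: open_INT)
qed

locale fa =
  fixes p :: "nat \<Rightarrow> nat" and lam :: "nat \<Rightarrow> nat \<Rightarrow> real \<Rightarrow> real"
  assumes FA: "floyd_auslander p lam"
begin

sublocale odo p
  using FA by unfold_locales (simp add: floyd_auslander_def)

lemma lam_cases:
  assumes "j < p n"
  obtains "lam n j = lam1" | "lam n j = lamh 0" | "lam n j = lamh 1"
  using FA assms unfolding floyd_auslander_def lam0_eq lam2_eq by blast

lemma lam_unit:
  assumes "j < p n" "z \<in> {0..1}" shows "lam n j z \<in> {0..1}"
  using assms(2) by (cases rule: lam_cases[OF assms(1)]) (auto simp: lam1_def lamh_def)

text \<open>
  The slope of the affine map \<open>lam_comp lam \<alpha> n\<close>, its limit \<open>S \<alpha>\<close>, which is the length of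
  the fibre over \<open>\<alpha>\<close>, and the affine map \<open>L \<alpha>\<close> from the unit interval onto that fibre.
\<close>

definition contr :: "(nat \<Rightarrow> nat) \<Rightarrow> nat \<Rightarrow> real" where
  "contr \<alpha> n = (1/2) ^ card {j. j < n \<and> lam j (\<alpha> j) \<noteq> lam1}"

definition S :: "(nat \<Rightarrow> nat) \<Rightarrow> real" where "S \<alpha> = lim (contr \<alpha>)"

definition L :: "(nat \<Rightarrow> nat) \<Rightarrow> real \<Rightarrow> real" where "L \<alpha> z = lim (\<lambda>n. lam_comp lam \<alpha> n z)"

lemma contr_0 [simp]: "contr \<alpha> 0 = 1"
  by (simp add: contr_def)

lemma contr_Suc: "contr \<alpha> (Suc n) = contr \<alpha> n * (if lam n (\<alpha> n) = lam1 then 1 else 1/2)"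
proof -
  have "{j. j < Suc n \<and> lam j (\<alpha> j) \<noteq> lam1} =
    (if lam n (\<alpha> n) = lam1 then {} else {n}) \<union> {j. j < n \<and> lam j (\<alpha> j) \<noteq> lam1}"
    by (auto simp: less_Suc_eq)
  then show ?thesis by (simp add: contr_def)
qed

lemma contr_pos: "contr \<alpha> n > 0"
  by (simp add: contr_def)

lemma contr_antimono: "m \<le> n \<Longrightarrow> contr \<alpha> n \<le> contr \<alpha> m"
  unfolding contr_def by (intro power_decreasing card_mono) auto

lemma contr_le_power:
  assumes "A \<subseteq> {j. j < n \<and> lam j (\<alpha> j) \<noteq> lam1}"
  shows "contr \<alpha> n \<le> (1/2) ^ card A"
  unfolding contr_def using assms by (intro power_decreasing card_mono) auto

lemma contr_cong: "(\<And>j. j < n \<Longrightarrow> \<alpha> j = \<beta> j) \<Longrightarrow> contr \<alpha> n = contr \<beta> n"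
  unfolding contr_def by (intro arg_cong[where f = "\<lambda>A. (1/2) ^ card A"]) auto

lemma lam_comp_cong: "(\<And>j. j < n \<Longrightarrow> \<alpha> j = \<beta> j) \<Longrightarrow> lam_comp lam \<alpha> n = lam_comp lam \<beta> n"
  by (induction n) auto

lemma lam_comp_affine:
  assumes "\<alpha> \<in> odometer p"
  shows "lam_comp lam \<alpha> n z = lam_comp lam \<alpha> n 0 + contr \<alpha> n * z"
proof (induction n arbitrary: z)
  case (Suc n)
  have "lam_comp lam \<alpha> (Suc n) z = lam_comp lam \<alpha> n 0 + contr \<alpha> n * lam n (\<alpha> n) z"
    using Suc[of "lam n (\<alpha> n) z"] by simp
  moreover have "lam_comp lam \<alpha> (Suc n) 0 = lam_comp lam \<alpha> n 0 + contr \<alpha> n * lam n (\<alpha> n) 0"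
    using Suc[of "lam n (\<alpha> n) 0"] by simp
  moreover have "lam n (\<alpha> n) z = lam n (\<alpha> n) 0 + (if lam n (\<alpha> n) = lam1 then 1 else 1/2) * z"
    by (cases rule: lam_cases[OF digit_less[OF assms, of n]])
      (auto simp: lamh_neq_lam1, auto simp: lamh_def lam1_def)
  ultimately show ?case by (simp add: contr_Suc algebra_simps)
qed simp

lemma lam_comp_split:
  assumes "\<alpha> \<in> odometer p" "m \<le> n" "z \<in> {0..1}"
  shows "\<exists>w\<in>{0..1}. lam_comp lam \<alpha> n z = lam_comp lam \<alpha> m w"
  using assms(2,3)
proof (induction n arbitrary: z rule: dec_induct)
  case (step n)
  then show ?case using step.IH[OF lam_unit[OF digit_less[OF assms(1), of n] step.prems]] by simp
qed blast

lemma lam_comp_unit: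
  assumes "\<alpha> \<in> odometer p" "z \<in> {0..1}" shows "lam_comp lam \<alpha> n z \<in> {0..1}"
  using lam_comp_split[OF assms(1) le0 assms(2), of n] by auto

lemma contr_lim: "contr \<alpha> \<longlonglongrightarrow> S \<alpha>"
proof -
  have "norm (contr \<alpha> n) \<le> 1" for n
    using contr_antimono[of 0 n \<alpha>] contr_pos[of \<alpha> n] by simp
  then have "Bseq (contr \<alpha>)" by (rule BseqI')
  moreover have "decseq (contr \<alpha>)" using contr_antimono by (simp add: decseq_def)
  ultimately have "convergent (contr \<alpha>)" by (simp add: Bseq_monoseq_convergent decseq_imp_monoseq)
  then show ?thesis by (simp add: S_def convergent_LIMSEQ_iff)
qed

lemma S_le_contr: "S \<alpha> \<le> contr \<alpha> n"
  using contr_antimono by (intro LIMSEQ_le_const2[OF contr_lim]) auto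

lemma S_nonneg: "0 \<le> S \<alpha>"
  using contr_pos by (intro LIMSEQ_le_const[OF contr_lim]) (auto intro: less_imp_le)

lemma L_lim:
  assumes "\<alpha> \<in> odometer p" shows "(\<lambda>n. lam_comp lam \<alpha> n z) \<longlonglongrightarrow> L \<alpha> z"
proof -
  have "incseq (\<lambda>n. lam_comp lam \<alpha> n 0)"
  proof (rule incseq_SucI)
    fix n
    have "lam n (\<alpha> n) 0 \<ge> 0" using lam_unit[OF digit_less[OF assms], of 0 n] by simp
    then show "lam_comp lam \<alpha> n 0 \<le> lam_comp lam \<alpha> (Suc n) 0"
      using lam_comp_affine[OF assms, of n "lam n (\<alpha> n) 0"] contr_pos[of \<alpha> n] by simp
  qed
  moreover have "norm (lam_comp lam \<alpha> n 0) \<le> 1" for n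
    using lam_comp_unit[OF assms, of 0 n] by simp
  then have "Bseq (\<lambda>n. lam_comp lam \<alpha> n 0)" by (rule BseqI')
  ultimately have "convergent (\<lambda>n. lam_comp lam \<alpha> n 0)"
    using Bseq_monoseq_convergent incseq_imp_monoseq by blast
  moreover have "convergent (\<lambda>n. contr \<alpha> n * z)"
    using contr_lim by (intro convergent_mult_const_right_iff[THEN iffD2] convergentI convergent_mult) auto
  ultimately have "convergent (\<lambda>n. lam_comp lam \<alpha> n z)"
    by (subst lam_comp_affine[OF assms]) (rule convergent_add)
  then show ?thesis by (simp add: L_def convergent_LIMSEQ_iff)
qed

lemma L_affine:
  assumes "\<alpha> \<in> odometer p" shows "L \<alpha> z = L \<alpha> 0 + S \<alpha> * z"
proof (rule LIMSEQ_unique[OF L_lim[OF assms]])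
  show "(\<lambda>n. lam_comp lam \<alpha> n z) \<longlonglongrightarrow> L \<alpha> 0 + S \<alpha> * z"
    by (subst lam_comp_affine[OF assms]) (intro tendsto_intros L_lim contr_lim assms)
qed

lemma L_split:
  assumes "\<alpha> \<in> odometer p" "z \<in> {0..1}"
  shows "\<exists>w\<in>{0..1}. L \<alpha> z = lam_comp lam \<alpha> m w"
proof -
  have "continuous_on {0..1} (\<lambda>w. lam_comp lam \<alpha> m 0 + contr \<alpha> m * w)" by (intro continuous_intros)
  then have "continuous_on {0..1} (lam_comp lam \<alpha> m)"
    by (subst continuous_on_cong[OF refl lam_comp_affine[OF assms(1)]])
  then have "closed (lam_comp lam \<alpha> m ` {0..1})"
    by (intro compact_imp_closed compact_continuous_image compact_Icc)
  moreover have "eventually (\<lambda>n. lam_comp lam \<alpha> n z \<in> lam_comp lam \<alpha> m ` {0..1}) sequentially"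
    using lam_comp_split[OF assms(1) _ assms(2), of m] by (intro eventually_sequentiallyI[of m]) blast
  ultimately have "L \<alpha> z \<in> lam_comp lam \<alpha> m ` {0..1}"
    by (rule Lim_in_closed_set[OF _ _ trivial_limit_sequentially L_lim[OF assms(1)]])
  then show ?thesis by blast
qed

lemma L_unit:
  assumes "\<alpha> \<in> odometer p" "z \<in> {0..1}" shows "L \<alpha> z \<in> {0..1}"
  using L_split[OF assms, of 0] by auto

lemma L_dist_le:
  assumes "\<alpha> \<in> odometer p" "z \<in> {0..1}" "z' \<in> {0..1}" shows "\<bar>L \<alpha> z - L \<alpha> z'\<bar> \<le> S \<alpha>"
proof -
  have "\<bar>L \<alpha> z - L \<alpha> z'\<bar> = S \<alpha> * \<bar>z - z'\<bar>"
    using L_affine[OF assms(1), of z] L_affine[OF assms(1), of z'] S_nonneg[of \<alpha>]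
    by (simp add: abs_mult flip: right_diff_distrib)
  also have "\<dots> \<le> S \<alpha> * 1" using assms S_nonneg by (intro mult_left_mono) (auto simp: abs_le_iff)
  finally show ?thesis by simp
qed

lemma S_zero_iff: "S \<alpha> = 0 \<longleftrightarrow> infinite {n. lam n (\<alpha> n) \<noteq> lam1}"
proof
  assume S0: "S \<alpha> = 0"
  show "infinite {n. lam n (\<alpha> n) \<noteq> lam1}"
  proof
    assume fin: "finite {n. lam n (\<alpha> n) \<noteq> lam1}"
    let ?c = "(1/2) ^ card {n. lam n (\<alpha> n) \<noteq> lam1} :: real"
    have "?c \<le> contr \<alpha> n" for n
      unfolding contr_def using fin by (intro power_decreasing card_mono) auto
    then have "?c \<le> S \<alpha>" by (intro LIMSEQ_le_const[OF contr_lim]) auto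
    moreover have "?c > 0" by simp
    ultimately show False using S0 by linarith
  qed
next
  assume inf: "infinite {n. lam n (\<alpha> n) \<noteq> lam1}"
  have "S \<alpha> \<le> (1/2) ^ k" for k
  proof -
    obtain A where A: "finite A" "card A = k" "A \<subseteq> {n. lam n (\<alpha> n) \<noteq> lam1}"
      using infinite_arbitrarily_large[OF inf] by blast
    obtain n where "\<forall>j\<in>A. j < n" using A(1) finite_nat_set_iff_bounded by auto
    then have "A \<subseteq> {j. j < n \<and> lam j (\<alpha> j) \<noteq> lam1}" using A(3) by blast
    from contr_le_power[OF this] show ?thesis using S_le_contr[of \<alpha> n] A(2) by simp
  qed
  moreover have "(\<lambda>k. (1/2 :: real) ^ k) \<longlonglongrightarrow> 0" by (rule LIMSEQ_realpow_zero) auto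
  ultimately have "S \<alpha> \<le> 0" by (intro LIMSEQ_le_const) auto
  then show "S \<alpha> = 0" using S_nonneg[of \<alpha>] by simp
qed

lemma zero_in_odometer: "(\<lambda>_. 0) \<in> odometer p"
  by (simp add: odometer_def)

lemma infinite_zero_contracting: "infinite {n. lam n 0 \<noteq> lam1}"
proof -
  have "infinite {n. lam n 0 \<in> {lam0, lam2}}" using FA by (simp add: floyd_auslander_def)
  moreover have "{n. lam n 0 \<in> {lam0, lam2}} \<subseteq> {n. lam n 0 \<noteq> lam1}"
    using lamh_neq_lam1 by (auto simp: lam0_eq lam2_eq)
  ultimately show ?thesis by (rule infinite_super[rotated])
qed

lemma S_shift_one:
  assumes "\<alpha> \<in> odometer p" "S \<alpha> = 0" shows "S (shift \<alpha> 1) = 0"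
proof (cases "shift \<alpha> 1 = (\<lambda>_. 0)")
  case True
  then show ?thesis using infinite_zero_contracting by (simp add: S_zero_iff)
next
  case False
  then obtain m where m: "\<forall>j\<ge>m. shift \<alpha> 1 j = \<alpha> j" using shift_one_tail[OF assms(1)] by blast
  have "{n. lam n (\<alpha> n) \<noteq> lam1} \<subseteq> {..<m} \<union> {n. lam n (shift \<alpha> 1 n) \<noteq> lam1}" 
    using m by (auto simp: not_less)
  then show ?thesis using assms(2) finite_subset by (auto simp: S_zero_iff)
qed

lemma fa_space_eq: "fa_space p lam = {(\<alpha>, L \<alpha> z) | \<alpha> z. \<alpha> \<in> odometer p \<and> z \<in> {0..1}}"
proof -
  have "(\<lambda>n. lam_comp lam \<alpha> n z) \<longlonglongrightarrow> y \<longleftrightarrow> y = L \<alpha> z" if "\<alpha> \<in> odometer p" for \<alpha> z y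
    using L_lim[OF that, of z] LIMSEQ_unique by blast
  then show ?thesis unfolding fa_space_def using L_unit by auto
qed

lemma fa_spaceE:
  assumes "x \<in> fa_space p lam"
  obtains \<alpha> z where "\<alpha> \<in> odometer p" "z \<in> {0..1}" "x = (\<alpha>, L \<alpha> z)"
  using assms by (auto simp: fa_space_eq)

lemma fa_spaceI: "\<alpha> \<in> odometer p \<Longrightarrow> z \<in> {0..1} \<Longrightarrow> (\<alpha>, L \<alpha> z) \<in> fa_space p lam"
  unfolding fa_space_eq by blast

text \<open>
  The choice of a preimage \<open>z'\<close> in the definition of \<open>fa_map\<close> does not matter: either the fibre
  over \<open>\<alpha>\<close> is nondegenerate and \<open>z'\<close> is unique, or the fibre over the successor of \<open>\<alpha>\<close> is
  degenerate as well.
\<close>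

lemma fa_map_L:
  assumes "\<alpha> \<in> odometer p" "z \<in> {0..1}"
  shows "fa_map p lam (\<alpha>, L \<alpha> z) = (shift \<alpha> 1, L (shift \<alpha> 1) z)"
proof -
  define z' where "z' = (SOME z'. z' \<in> {0..1} \<and> (\<lambda>n. lam_comp lam \<alpha> n z') \<longlonglongrightarrow> L \<alpha> z)"
  have "z' \<in> {0..1} \<and> (\<lambda>n. lam_comp lam \<alpha> n z') \<longlonglongrightarrow> L \<alpha> z"
    unfolding z'_def by (rule someI[of _ z]) (use assms L_lim in blast)
  then have "L \<alpha> z' = L \<alpha> z" using L_lim[OF assms(1)] LIMSEQ_unique by blast
  then have "S \<alpha> * z' = S \<alpha> * z"
    using L_affine[OF assms(1), of z] L_affine[OF assms(1), of z'] by simp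
  then have "z' = z \<or> S (shift \<alpha> 1) = 0" using S_shift_one[OF assms(1)] by auto
  then have "L (shift \<alpha> 1) z' = L (shift \<alpha> 1) z"
    using L_affine[OF shift_in_odometer, of \<alpha> 1 z] L_affine[OF shift_in_odometer, of \<alpha> 1 z'] by auto
  then show ?thesis
    unfolding fa_map_def prod.case Let_def z'_def[symmetric] odo_add_one[OF assms(1)]
    by (simp add: L_def)
qed

lemma fa_map_iter:
  assumes "\<alpha> \<in> odometer p" "z \<in> {0..1}"
  shows "(fa_map p lam ^^ n) (\<alpha>, L \<alpha> z) = (shift \<alpha> n, L (shift \<alpha> n) z)"
proof (induction n)
  case 0 show ?case using assms by (simp add: shift_0)
next
  case (Suc n)
  then show ?case using fa_map_L[OF shift_in_odometer assms(2), of \<alpha> n] by (simp add: shift_plus)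
qed

lemma fa_map_into: "fa_map p lam \<in> fa_space p lam \<rightarrow> fa_space p lam"
  using fa_map_L by (auto simp: fa_space_eq)

lemma compact_odometer: "compact (odometer p)"
proof -
  have "odometer p = PiE UNIV (\<lambda>n. {..<p n})" by (auto simp: odometer_def PiE_def)
  then have "compactin (product_topology (\<lambda>_. euclidean) UNIV) (odometer p)"
    by (simp add: compactin_PiE finite_imp_compact)
  then show ?thesis by (simp add: euclidean_product_topology)
qed

lemma closed_odometer: "closed (odometer p)"
proof -
  have "odometer p = (\<Inter>n. (\<lambda>\<alpha>. \<alpha> n) -` {..<p n})" by (auto simp: odometer_def)
  moreover have "closed ((\<lambda>\<alpha> :: nat \<Rightarrow> nat. \<alpha> n) -` {..<p n})" for n
    by (intro closed_vimage continuous_on_product_coordinates) (simp add: closed_def open_discrete)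
  ultimately show ?thesis by (simp add: closed_INT)
qed

text \<open>The fibre over \<open>\<alpha>\<close> is the intersection of the images of the maps \<open>lam_comp lam \<alpha> n\<close>.\<close>

lemma compact_fa_space: "compact (fa_space p lam)"
proof -
  let ?C = "odometer p \<times> {0..1::real}"
  define D where "D n = {x \<in> ?C. snd x \<in> lam_comp lam (fst x) n ` {0..1}}" for n
  have "fa_space p lam = (\<Inter>n. D n)"
  proof
    show "fa_space p lam \<subseteq> (\<Inter>n. D n)"
      using L_split L_unit by (fastforce simp: D_def fa_space_eq)
    show "(\<Inter>n. D n) \<subseteq> fa_space p lam"
    proof
      fix x assume x: "x \<in> (\<Inter>n. D n)"
      obtain \<alpha> y where xy: "x = (\<alpha>, y)" by fastforce
      have \<alpha>: "\<alpha> \<in> odometer p" using x by (auto simp: D_def xy)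
      have bd: "lam_comp lam \<alpha> n 0 \<le> y \<and> y \<le> lam_comp lam \<alpha> n 1" for n
      proof -
        have "y \<in> lam_comp lam \<alpha> n ` {0..1}" using x by (auto simp: D_def xy)
        then obtain w where "w \<in> {0..1}" "y = lam_comp lam \<alpha> n w" by blast
        then show ?thesis
          using lam_comp_affine[OF \<alpha>, of n w] lam_comp_affine[OF \<alpha>, of n 1] contr_pos[of \<alpha> n]
          by (auto simp: mult_le_cancel_left1 zero_le_mult_iff)
      qed
      have bdL: "L \<alpha> 0 \<le> y" "y \<le> L \<alpha> 0 + S \<alpha>"
        using bd LIMSEQ_le_const2[OF L_lim[OF \<alpha>], of 0 y] LIMSEQ_le_const[OF L_lim[OF \<alpha>], of y 1]
          L_affine[OF \<alpha>, of 1] by auto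
      define z where "z = (if S \<alpha> = 0 then 0 else (y - L \<alpha> 0) / S \<alpha>)"
      have "z \<in> {0..1}" "y = L \<alpha> 0 + S \<alpha> * z"
        using bdL S_nonneg[of \<alpha>] by (auto simp: z_def field_simps)
      then show "x \<in> fa_space p lam"
        using fa_spaceI[OF \<alpha>, of z] L_affine[OF \<alpha>, of z] by (simp add: xy)
    qed
  qed
  then have "fa_space p lam = ?C \<inter> (\<Inter>n. D n)" by (auto simp: D_def)
  moreover have "closed (D n)" for n
  proof -
    have "open (- D n)"
    proof (subst open_subopen, intro ballI)
      fix x assume x: "x \<in> - D n"
      have clC: "closed ?C" by (intro closed_Times closed_odometer) simp
      show "\<exists>V. open V \<and> x \<in> V \<and> V \<subseteq> - D n"
      proof (cases "x \<in> ?C")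
        case False
        then show ?thesis using clC by (intro exI[of _ "- ?C"]) (auto simp: closed_def D_def)
      next
        case True
        obtain \<alpha> y where xy: "x = (\<alpha>, y)" by fastforce
        have "\<alpha> \<in> odometer p" using True xy by simp
        then have "continuous_on {0..1} (lam_comp lam \<alpha> n)"
          by (subst continuous_on_cong[OF refl lam_comp_affine]) (auto intro!: continuous_intros)
        then have "closed (lam_comp lam \<alpha> n ` {0..1})"
          by (intro compact_imp_closed compact_continuous_image compact_Icc)
        then have "open ({\<delta>. \<forall>i<n. \<delta> i = \<alpha> i} \<times> (- lam_comp lam \<alpha> n ` {0..1}))"
          by (intro open_Times open_cylinder) (simp add: closed_def)
        moreover have "x \<in> {\<delta>. \<forall>i<n. \<delta> i = \<alpha> i} \<times> (- lam_comp lam \<alpha> n ` {0..1})"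
          using x True by (auto simp: xy D_def)
        moreover have "(\<delta>, y') \<notin> D n"
          if "\<forall>i<n. \<delta> i = \<alpha> i" "y' \<notin> lam_comp lam \<alpha> n ` {0..1}" for \<delta> y'
        proof -
          have "lam_comp lam \<delta> n = lam_comp lam \<alpha> n" using that(1) by (intro lam_comp_cong) auto
          then show ?thesis using that(2) by (simp add: D_def)
        qed
        then have "{\<delta>. \<forall>i<n. \<delta> i = \<alpha> i} \<times> (- lam_comp lam \<alpha> n ` {0..1}) \<subseteq> - D n" by blast
        ultimately show ?thesis by blast
      qed
    qed
    then show ?thesis by (simp add: closed_def)
  qed
  moreover have "compact ?C" using compact_odometer by (intro compact_Times) auto
  ultimately show ?thesis using compact_Int_closed[of ?C "\<Inter>n. D n"] by (simp add: closed_INT)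
qed

end

section \<open>Elements of the Ellis semigroup of a Floyd-Auslander system\<close>

lemma tendsto_fst_digits:
  fixes x :: "'b \<Rightarrow> (nat \<Rightarrow> nat) \<times> real"
  assumes "(x \<longlongrightarrow> l) F" shows "eventually (\<lambda>i. \<forall>j<N. fst (x i) j = fst l j) F"
proof -
  have "open ({\<delta>. \<forall>j<N. \<delta> j = fst l j} \<times> (UNIV :: real set))"
    by (intro open_Times open_cylinder open_UNIV)
  from topological_tendstoD[OF assms this]
  show ?thesis by (rule eventually_mono) (auto simp: mem_Times_iff)
qed

lemma infinite_card_ge:
  assumes "infinite (A :: nat set)" shows "\<exists>e\<ge>m. k \<le> card (A \<inter> {m..<e})"
proof -
  have "infinite (A - {..<m})" using assms by simp
  then obtain B where B: "finite B" "card B = k" "B \<subseteq> A - {..<m}"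
    using infinite_arbitrarily_large by blast
  obtain b where "\<forall>j\<in>B. j < b" using B(1) finite_nat_set_iff_bounded by auto
  then have "B \<subseteq> A \<inter> {m..<max m b}" using B(3) by force
  then have "k \<le> card (A \<inter> {m..<max m b})" using B(2) card_mono[of "A \<inter> {m..<max m b}" B] by auto
  then show ?thesis by (intro exI[of _ "max m b"]) simp
qed

lemma mod_add_cancel:
  fixes a b c P :: nat
  assumes "(a + c) mod P = (b + c) mod P" "a < P" "b < P" shows "a = b"
proof -
  have *: "a = b" if "(a + c) mod P = (b + c) mod P" "a \<le> b" "b < P" for a b
  proof -
    have "P dvd (b + c) - (a + c)" using that by (subst mod_eq_dvd_iff_nat[symmetric]) auto
    then show ?thesis using that by (auto dest!: dvd_imp_le)
  qed
  show ?thesis using *[of a b] *[of b a] assms by (cases "a \<le> b") auto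
qed

context fa
begin

abbreviation X :: "((nat \<Rightarrow> nat) \<times> real) set" where "X \<equiv> fa_space p lam"
abbreviation T :: "(nat \<Rightarrow> nat) \<times> real \<Rightarrow> (nat \<Rightarrow> nat) \<times> real" where "T \<equiv> fa_map p lam"

lemma ellis_limitE:
  assumes "f \<in> ellis X T"
  obtains G where "G \<noteq> bot"
    "\<And>\<alpha> z N. \<alpha> \<in> odometer p \<Longrightarrow> z \<in> {0..1} \<Longrightarrow>
       eventually (\<lambda>n. \<forall>j<N. shift \<alpha> n j = fst (f (\<alpha>, L \<alpha> z)) j) G"
    "\<And>\<alpha> z. \<alpha> \<in> odometer p \<Longrightarrow> z \<in> {0..1} \<Longrightarrow>
       ((\<lambda>n. L (shift \<alpha> n) z) \<longlongrightarrow> snd (f (\<alpha>, L \<alpha> z))) G"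
proof -
  obtain G where G: "G \<noteq> bot" "\<And>x. x \<in> X \<Longrightarrow> ((\<lambda>n. (T ^^ n) x) \<longlongrightarrow> f x) G"
    using assms unfolding ellis_iff_limit[OF fa_map_into] by blast
  have lim: "((\<lambda>n. (shift \<alpha> n, L (shift \<alpha> n) z)) \<longlongrightarrow> f (\<alpha>, L \<alpha> z)) G"
    if "\<alpha> \<in> odometer p" "z \<in> {0..1}" for \<alpha> z
    using G(2)[OF fa_spaceI[OF that]] by (simp add: fa_map_iter[OF that])
  show thesis
  proof (rule that[OF G(1)])
    fix \<alpha> z N assume "\<alpha> \<in> odometer p" "z \<in> {0..1::real}"
    from lim[OF this] show "eventually (\<lambda>n. \<forall>j<N. shift \<alpha> n j = fst (f (\<alpha>, L \<alpha> z)) j) G"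
      by (auto dest: tendsto_fst_digits)
    from lim[OF \<open>\<alpha> \<in> odometer p\<close> \<open>z \<in> {0..1}\<close>]
    show "((\<lambda>n. L (shift \<alpha> n) z) \<longlongrightarrow> snd (f (\<alpha>, L \<alpha> z))) G"
      by (auto dest: tendsto_snd)
  qed
qed

lemma ellis_into: "f \<in> ellis X T \<Longrightarrow> x \<in> X \<Longrightarrow> f x \<in> X"
  using ellis_subset by blast

lemma fst_in_odometer: "x \<in> X \<Longrightarrow> fst x \<in> odometer p"
  by (auto elim: fa_spaceE)

text \<open>
  On the odometer, an element of the Ellis semigroup acts as the translation by its value at zero.
\<close>

definition translation :: "((nat \<Rightarrow> nat) \<times> real \<Rightarrow> (nat \<Rightarrow> nat) \<times> real) \<Rightarrow> nat \<Rightarrow> nat" where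
  "translation f = fst (f (\<lambda>_. 0, L (\<lambda>_. 0) 0))"

lemma val_zero: "val (\<lambda>_. 0) m = 0"
  by (simp add: val_def)

lemma ellis_val:
  assumes f: "f \<in> ellis X T" and \<alpha>: "\<alpha> \<in> odometer p" "z \<in> {0..1}"
  shows "val (fst (f (\<alpha>, L \<alpha> z))) m = (val \<alpha> m + val (translation f) m) mod P m"
proof -
  obtain G where "G \<noteq> bot"
    and G: "\<And>\<alpha> z N. \<alpha> \<in> odometer p \<Longrightarrow> z \<in> {0..1} \<Longrightarrow>
       eventually (\<lambda>n. \<forall>j<N. shift \<alpha> n j = fst (f (\<alpha>, L \<alpha> z)) j) G"
    by (rule ellis_limitE[OF f]) blast
  have "eventually (\<lambda>n. (\<forall>j<m. shift \<alpha> n j = fst (f (\<alpha>, L \<alpha> z)) j) \<and>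
      (\<forall>j<m. shift (\<lambda>_. 0) n j = translation f j)) G"
    using G[OF \<alpha>] G[OF zero_in_odometer, of 0] unfolding translation_def by (intro eventually_conj) auto
  then obtain n where n: "\<forall>j<m. shift \<alpha> n j = fst (f (\<alpha>, L \<alpha> z)) j"
    "\<forall>j<m. shift (\<lambda>_. 0) n j = translation f j"
    using eventually_happens'[OF \<open>G \<noteq> bot\<close>] by blast
  have "val (fst (f (\<alpha>, L \<alpha> z))) m = (val \<alpha> m + n) mod P m"
    using n(1) val_cong[of m "shift \<alpha> n" "fst (f (\<alpha>, L \<alpha> z))"] by (simp add: val_shift)
  moreover have "val (translation f) m = n mod P m"
    using n(2) val_cong[of m "shift (\<lambda>_. 0) n" "translation f"] by (simp add: val_shift val_zero)
  ultimately show ?thesis by (simp add: mod_add_right_eq)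
qed

lemma ellis_affine:
  assumes f: "f \<in> ellis X T" and \<alpha>: "\<alpha> \<in> odometer p" and z: "z \<in> {0..1}"
  shows "snd (f (\<alpha>, L \<alpha> z)) = (1 - z) * snd (f (\<alpha>, L \<alpha> 0)) + z * snd (f (\<alpha>, L \<alpha> 1))"
proof -
  obtain G where "G \<noteq> bot" and G: "\<And>\<alpha> z. \<alpha> \<in> odometer p \<Longrightarrow> z \<in> {0..1} \<Longrightarrow>
       ((\<lambda>n. L (shift \<alpha> n) z) \<longlongrightarrow> snd (f (\<alpha>, L \<alpha> z))) G"
    by (rule ellis_limitE[OF f]) blast
  have "L (shift \<alpha> n) z = (1 - z) * L (shift \<alpha> n) 0 + z * L (shift \<alpha> n) 1" for n
    using L_affine[OF shift_in_odometer, of \<alpha> n z] L_affine[OF shift_in_odometer, of \<alpha> n 1]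
    by (simp add: algebra_simps)
  moreover have "((\<lambda>n. (1 - z) * L (shift \<alpha> n) 0 + z * L (shift \<alpha> n) 1) \<longlongrightarrow>
      (1 - z) * snd (f (\<alpha>, L \<alpha> 0)) + z * snd (f (\<alpha>, L \<alpha> 1))) G"
    by (intro tendsto_intros G \<alpha>) auto
  ultimately show ?thesis using tendsto_unique[OF \<open>G \<noteq> bot\<close> G[OF \<alpha> z]] by simp
qed

subsection \<open>A small Ellis semigroup\<close>

text \<open>
  If all but finitely many sets \<open>fa_Q p lam n\<close> have at most one element, only countably many
  fibres are nondegenerate, and an element of the Ellis semigroup is determined by its
  translation and by its values at the ends of the fibres that it maps to nondegenerate ones.
\<close>

lemma ellis_small:
  assumes q: "\<And>n j. N \<le> n \<Longrightarrow> j < p n \<Longrightarrow> lam n j = lam1 \<Longrightarrow> j = q n"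
  shows "ellis X T \<lesssim> (UNIV :: nat set set)"
proof -
  define tailseq where "tailseq l = (\<lambda>n. if n < length l then l ! n else q n)" for l :: "nat list"
  have nondeg: "\<exists>l. \<beta> = tailseq l" if "\<beta> \<in> odometer p" "S \<beta> \<noteq> 0" for \<beta>
  proof -
    have "finite {n. lam n (\<beta> n) \<noteq> lam1}" using that(2) by (simp add: S_zero_iff)
    then obtain m where m: "\<And>n. lam n (\<beta> n) \<noteq> lam1 \<Longrightarrow> n < m"
      using finite_nat_set_iff_bounded by auto
    have "\<beta> n = q n" if "n \<ge> max m N" for n
      using q[of n "\<beta> n"] m[of n] that digit_less[OF \<open>\<beta> \<in> odometer p\<close>, of n] by force
    then have "\<beta> = tailseq (map \<beta> [0..<max m N])"
      by (intro ext) (simp add: tailseq_def not_less)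
    then show ?thesis ..
  qed
  define pre where "pre f l = (SOME \<alpha>. \<alpha> \<in> odometer p \<and> fst (f (\<alpha>, L \<alpha> 0)) = tailseq l)"
    for f :: "(nat \<Rightarrow> nat) \<times> real \<Rightarrow> (nat \<Rightarrow> nat) \<times> real" and l
  \<comment> \<open>Real numbers are coded by the rationals below them.\<close>
  define code where "code f = Inl ` {(n, translation f n) | n. True} \<union>
      Inr ` {(l, b, r). real_of_rat r < snd (f (pre f l, L (pre f l) (of_bool b)))}"
    for f :: "(nat \<Rightarrow> nat) \<times> real \<Rightarrow> (nat \<Rightarrow> nat) \<times> real"
  have "inj_on code (ellis X T)"
  proof (rule inj_onI)
    fix f g assume f: "f \<in> ellis X T" and g: "g \<in> ellis X T" and eq: "code f = code g"
    have "translation f n = translation g n" for n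
    proof -
      have "Inl (n, translation f n) \<in> code f" by (auto simp: code_def)
      then show ?thesis unfolding eq by (auto simp: code_def)
    qed
    then have tr: "translation f = translation g" by blast
    have fst: "fst (f (\<alpha>, L \<alpha> z)) = fst (g (\<alpha>, L \<alpha> z'))"
      if "\<alpha> \<in> odometer p" "z \<in> {0..1}" "z' \<in> {0..1}" for \<alpha> z z'
      by (rule odometer_eqI)
        (use that f g in \<open>simp_all add: ellis_val tr fst_in_odometer ellis_into fa_spaceI\<close>)
    have "\<alpha> \<in> odometer p \<and> fst (f (\<alpha>, L \<alpha> 0)) = \<beta> \<longleftrightarrow> \<alpha> \<in> odometer p \<and> fst (g (\<alpha>, L \<alpha> 0)) = \<beta>" for \<alpha> \<beta>
      using fst[of \<alpha> 0 0] by auto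
    then have pre: "pre f = pre g" unfolding pre_def by (intro ext) simp
    have ends: "snd (f (pre f l, L (pre f l) (of_bool b))) = snd (g (pre f l, L (pre f l) (of_bool b)))"
      (is "?x = ?y") for l b
    proof -
      have "real_of_rat r < ?x \<longleftrightarrow> real_of_rat r < ?y" for r
      proof -
        have "Inr (l, b, r) \<in> code f \<longleftrightarrow> Inr (l, b, r) \<in> code g" by (simp add: eq)
        then show ?thesis by (auto simp: code_def pre)
      qed
      then show ?thesis by (metis linorder_neqE of_rat_dense order_less_not_sym)
    qed
    show "f = g"
    proof (rule PiE_ext[of f X "\<lambda>_. X"])
      show "f \<in> X \<rightarrow>\<^sub>E X" "g \<in> X \<rightarrow>\<^sub>E X" using f g ellis_subset by blast+
      fix x assume x: "x \<in> X"
      then obtain \<alpha> z where \<alpha>: "\<alpha> \<in> odometer p" "z \<in> {0..1}" "x = (\<alpha>, L \<alpha> z)" by (rule fa_spaceE)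
      obtain \<beta> u where \<beta>: "\<beta> \<in> odometer p" "f x = (\<beta>, L \<beta> u)"
        using ellis_into[OF f x] by (auto elim: fa_spaceE)
      obtain u' where u': "g x = (\<beta>, L \<beta> u')"
        using ellis_into[OF g x] fst[OF \<alpha>(1,2,2)] \<beta>(2) \<alpha>(3) by (auto elim: fa_spaceE)
      show "f x = g x"
      proof (cases "S \<beta> = 0")
        case True
        then show ?thesis using L_affine[OF \<beta>(1), of u] L_affine[OF \<beta>(1), of u'] \<beta>(2) u' by simp
      next
        case False
        then obtain l where l: "\<beta> = tailseq l" using nondeg \<beta>(1) by blast
        have "fst (f (\<alpha>, L \<alpha> 0)) = fst (f (\<alpha>, L \<alpha> z))"
          using fst[OF \<alpha>(1), of 0 0] fst[OF \<alpha>(1,2), of 0] by simp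
        then have \<alpha>_pre: "\<alpha> \<in> odometer p \<and> fst (f (\<alpha>, L \<alpha> 0)) = tailseq l" using \<alpha> \<beta>(2) l by simp
        then have pre_l: "pre f l \<in> odometer p \<and> fst (f (pre f l, L (pre f l) 0)) = tailseq l"
          unfolding pre_def
          by (rule someI[where P = "\<lambda>\<alpha>. \<alpha> \<in> odometer p \<and> fst (f (\<alpha>, L \<alpha> 0)) = tailseq l"])
        have "pre f l = \<alpha>"
        proof (rule odometer_eqI)
          fix m
          have "val (fst (f (pre f l, L (pre f l) 0))) m = val (fst (f (\<alpha>, L \<alpha> 0))) m"
            using \<alpha>_pre pre_l by simp
          then have "(val (pre f l) m + val (translation f) m) mod P m = (val \<alpha> m + val (translation f) m) mod P m"
            using ellis_val[OF f, of "pre f l" 0 m] ellis_val[OF f, of \<alpha> 0 m] \<alpha> pre_l by simp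
          then show "val (pre f l) m = val \<alpha> m"
            by (rule mod_add_cancel) (use \<alpha> pre_l val_less in auto)
        qed (use \<alpha> pre_l in auto)
        then have "snd (f (\<alpha>, L \<alpha> 0)) = snd (g (\<alpha>, L \<alpha> 0))" "snd (f (\<alpha>, L \<alpha> 1)) = snd (g (\<alpha>, L \<alpha> 1))"
          using ends[of l False] ends[of l True] by simp_all
        then have "snd (f x) = snd (g x)"
          unfolding \<alpha>(3) ellis_affine[OF f \<alpha>(1,2)] ellis_affine[OF g \<alpha>(1,2)] by simp
        then show ?thesis using \<beta>(2) u' by simp
      qed
    qed
  qed
  then have "inj_on (\<lambda>f. to_nat ` code f) (ellis X T)"
    by (simp add: inj_on_def inj_image_eq_iff[OF inj_to_nat])
  then show ?thesis by (auto simp: lepoll_def)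
qed

subsection \<open>Minimal idempotents\<close>

text \<open>
  An element of the Ellis semigroup that collapses every fibre to a point of that fibre absorbs
  every idempotent on its right, because idempotents preserve the fibres.
\<close>

lemma minimal_idempotentI:
  assumes f: "f \<in> ellis X T"
    and fst: "\<And>\<alpha> z. \<alpha> \<in> odometer p \<Longrightarrow> z \<in> {0..1} \<Longrightarrow> fst (f (\<alpha>, L \<alpha> z)) = \<alpha>"
    and const: "\<And>\<alpha> z z'. \<alpha> \<in> odometer p \<Longrightarrow> z \<in> {0..1} \<Longrightarrow> z' \<in> {0..1} \<Longrightarrow>
      f (\<alpha>, L \<alpha> z) = f (\<alpha>, L \<alpha> z')"
  shows "f \<in> minimal_idempotents X T"
proof -
  have absorb: "compose X f e = f"
    if e: "e \<in> ellis X T" and fst_e: "\<And>x. x \<in> X \<Longrightarrow> fst (e x) = fst x" for e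
  proof (rule extensionalityI[of _ X])
    have "f \<in> X \<rightarrow>\<^sub>E X" using f ellis_subset by blast
    then show "f \<in> extensional X" by (simp add: PiE_iff)
    fix x assume x: "x \<in> X"
    then obtain \<alpha> z where \<alpha>: "\<alpha> \<in> odometer p" "z \<in> {0..1}" "x = (\<alpha>, L \<alpha> z)" by (rule fa_spaceE)
    obtain z' where z': "z' \<in> {0..1}" "e x = (\<alpha>, L \<alpha> z')"
      using ellis_into[OF e x] fst_e[OF x] \<alpha>(3) by (auto elim: fa_spaceE)
    show "compose X f e x = f x"
      using const[OF \<alpha>(1) z'(1) \<alpha>(2)] x z'(2) by (simp add: compose_eq flip: \<alpha>(3))
  qed simp
  have "fst (f x) = fst x" if "x \<in> X" for x
    using that fst by (elim fa_spaceE) simp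
  then have "f \<in> idempotents X T" using f absorb[OF f] by (simp add: idempotents_def)
  moreover have "idem_le X f e" if e: "e \<in> idempotents X T" for e
  proof -
    have eE: "e \<in> ellis X T" and ee: "compose X e e = e" using e by (auto simp: idempotents_def)
    have "val (translation e) m = 0" for m
    proof -
      let ?x0 = "(\<lambda>_. 0, L (\<lambda>_. 0) 0)"
      have x0: "?x0 \<in> X" using zero_in_odometer by (intro fa_spaceI) auto
      obtain \<beta> u where \<beta>: "\<beta> \<in> odometer p" "u \<in> {0..1}" "e ?x0 = (\<beta>, L \<beta> u)"
        using ellis_into[OF eE x0] by (rule fa_spaceE)
      have "e (e ?x0) = e ?x0" using ee x0 by (metis compose_eq)
      then have eq: "(val (translation e) m + val \<beta> m) mod P m = (0 + val \<beta> m) mod P m"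
        using ellis_val[OF eE \<beta>(1,2), of m] \<beta> val_less[OF \<beta>(1), of m] by (simp add: add.commute)
      have "translation e \<in> odometer p"
        using fst_in_odometer[OF ellis_into[OF eE x0]] by (simp add: translation_def)
      then show ?thesis using mod_add_cancel[OF eq] val_less by simp
    qed
    note val_e = this
    have "fst (e x) = fst x" if x: "x \<in> X" for x
    proof -
      obtain \<alpha> z where \<alpha>: "\<alpha> \<in> odometer p" "z \<in> {0..1}" "x = (\<alpha>, L \<alpha> z)" using x by (rule fa_spaceE)
      have "fst (e x) = \<alpha>"
      proof (rule odometer_eqI)
        show "fst (e x) \<in> odometer p" using fst_in_odometer ellis_into[OF eE x] by blast
        show "val (fst (e x)) n = val \<alpha> n" for n
          using ellis_val[OF eE \<alpha>(1,2), of n] val_less[OF \<alpha>(1), of n] by (simp add: val_e \<alpha>(3))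
      qed (rule \<alpha>(1))
      then show ?thesis by (simp add: \<alpha>(3))
    qed
    from absorb[OF eE this] show ?thesis by (simp add: idem_le_def)
  qed
  ultimately show ?thesis by (simp add: minimal_idempotents_def)
qed

text \<open>
  The limit along \<open>U\<close> fixes the odometer because the iterates used are divisible by every place
  value, and it collapses the fibres because their images become arbitrarily short.
\<close>

lemma minimal_idempotent_of_ultrafilter:
  assumes U: "U \<in> nat_ultrafilters" "eventually (\<lambda>n. n \<ge> 1) U"
    and dvd: "\<And>m. eventually (\<lambda>n. P m dvd n) U"
    and S: "\<And>\<alpha> K. \<alpha> \<in> odometer p \<Longrightarrow> eventually (\<lambda>n. S (shift \<alpha> n) \<le> (1/2) ^ K) U"
  shows "\<exists>f\<in>minimal_idempotents X T. \<forall>\<alpha>\<in>odometer p. \<forall>z\<in>{0..1}.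
    ((\<lambda>n. L (shift \<alpha> n) z) \<longlongrightarrow> snd (f (\<alpha>, L \<alpha> z))) U"
proof -
  obtain f where f: "f \<in> ellis X T" "\<And>x. x \<in> X \<Longrightarrow> ((\<lambda>n. (T ^^ n) x) \<longlongrightarrow> f x) U"
    using ellis_of_ultrafilter[OF compact_fa_space fa_map_into U(1), where n = "\<lambda>n. n"] U(2) by blast
  have nb: "U \<noteq> bot" using U by (simp add: nat_ultrafilters_def)
  have lim: "((\<lambda>n. (shift \<alpha> n, L (shift \<alpha> n) z)) \<longlongrightarrow> f (\<alpha>, L \<alpha> z)) U"
    if "\<alpha> \<in> odometer p" "z \<in> {0..1}" for \<alpha> z
    using f(2)[OF fa_spaceI[OF that]] by (simp add: fa_map_iter[OF that])
  have snd: "((\<lambda>n. L (shift \<alpha> n) z) \<longlongrightarrow> snd (f (\<alpha>, L \<alpha> z))) U"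
    if "\<alpha> \<in> odometer p" "z \<in> {0..1}" for \<alpha> z
    using tendsto_snd[OF lim[OF that]] by simp
  have fst: "fst (f (\<alpha>, L \<alpha> z)) = \<alpha>" if \<alpha>: "\<alpha> \<in> odometer p" "z \<in> {0..1}" for \<alpha> z
  proof
    fix j
    have "eventually (\<lambda>n. \<alpha> j = fst (f (\<alpha>, L \<alpha> z)) j) U"
      using tendsto_fst_digits[OF lim[OF \<alpha>], of "Suc j"] dvd[of "Suc j"]
    proof eventually_elim
      case (elim n)
      then show ?case using shift_low[OF \<alpha>(1), of "Suc j" n j] by simp
    qed
    then show "fst (f (\<alpha>, L \<alpha> z)) j = \<alpha> j" using nb by simp
  qed
  have const: "f (\<alpha>, L \<alpha> z) = f (\<alpha>, L \<alpha> z')"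
    if \<alpha>: "\<alpha> \<in> odometer p" and z: "z \<in> {0..1}" "z' \<in> {0..1}" for \<alpha> z z'
  proof -
    let ?d = "\<bar>snd (f (\<alpha>, L \<alpha> z)) - snd (f (\<alpha>, L \<alpha> z'))\<bar>"
    have "?d \<le> (1/2) ^ K" for K
    proof (rule tendsto_upperbound)
      show "((\<lambda>n. \<bar>L (shift \<alpha> n) z - L (shift \<alpha> n) z'\<bar>) \<longlongrightarrow> ?d) U"
        by (intro tendsto_intros snd \<alpha> z)
      show "eventually (\<lambda>n. \<bar>L (shift \<alpha> n) z - L (shift \<alpha> n) z'\<bar> \<le> (1/2) ^ K) U"
        using S[OF \<alpha>, of K]
      proof eventually_elim
        case (elim n)
        then show ?case using L_dist_le[OF shift_in_odometer z, of \<alpha> n] by simp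
      qed
    qed (rule nb)
    moreover have "(\<lambda>k. (1/2 :: real) ^ k) \<longlonglongrightarrow> 0" by (rule LIMSEQ_realpow_zero) auto
    ultimately have "?d \<le> 0" by (intro LIMSEQ_le_const) auto
    then show ?thesis using fst[OF \<alpha> z(1)] fst[OF \<alpha> z(2)] by (simp add: prod_eq_iff)
  qed
  show ?thesis using minimal_idempotentI[OF f(1) fst const] snd by blast
qed

text \<open>
  Finitely many fibres can be contracted simultaneously: digits zero at high positions, where
  \<open>lam n 0\<close> is a contraction infinitely often, are produced for one element after the other.
\<close>

lemma contract_finitely_many:
  assumes "finite F" "F \<subseteq> odometer p"
  shows "\<exists>n M. n \<ge> 1 \<and> P m dvd n \<and> (\<forall>\<alpha>\<in>F. contr (shift \<alpha> n) M \<le> (1/2) ^ K)"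
  using assms
proof (induction F)
  case empty
  show ?case by (rule exI[of _ "P m"]) (auto simp: Suc_le_eq)
next
  case (insert \<alpha> F)
  then obtain n1 M1 where n1: "n1 \<ge> 1" "P m dvd n1" "\<And>\<beta>. \<beta> \<in> F \<Longrightarrow> contr (shift \<beta> n1) M1 \<le> (1/2) ^ K"
    by auto
  define c where "c = max m M1"
  let ?Z = "{n. lam n 0 \<noteq> lam1}"
  obtain e where e: "c \<le> e" "K \<le> card (?Z \<inter> {c..<e})"
    using infinite_card_ge[OF infinite_zero_contracting] by blast
  define w where "w j = (if j < c then shift \<alpha> n1 j else 0)" for j
  have "w \<in> odometer p" using shift_in_odometer[of \<alpha> n1] by (simp add: w_def odometer_def)
  then obtain n2 where n2: "P c dvd n2" "\<And>j. j < e \<Longrightarrow> shift (shift \<alpha> n1) n2 j = w j"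
    using shift_steer[OF shift_in_odometer, of w c e \<alpha> n1] e(1) by (auto simp: w_def)
  let ?n = "n1 + n2"
  have "contr (shift \<alpha> ?n) e \<le> (1/2) ^ card (?Z \<inter> {c..<e})"
  proof (rule contr_le_power)
    show "?Z \<inter> {c..<e} \<subseteq> {j. j < e \<and> lam j (shift \<alpha> ?n j) \<noteq> lam1}"
      using n2(2) by (auto simp: shift_plus w_def)
  qed
  also have "\<dots> \<le> (1/2) ^ K" using e(2) by (intro power_decreasing) auto
  finally have \<alpha>: "contr (shift \<alpha> ?n) e \<le> (1/2) ^ K" .
  have F: "contr (shift \<beta> ?n) e \<le> (1/2) ^ K" if "\<beta> \<in> F" for \<beta>
  proof -
    have "contr (shift \<beta> ?n) e \<le> contr (shift \<beta> ?n) M1" using e(1) by (intro contr_antimono) (simp add: c_def)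
    also have "\<dots> = contr (shift \<beta> n1) M1"
      using shift_low[OF shift_in_odometer n2(1), of _ \<beta> n1]
      by (intro contr_cong) (simp add: c_def flip: shift_plus)
    also have "\<dots> \<le> (1/2) ^ K" using n1(3) that by blast
    finally show ?thesis .
  qed
  have "P m dvd n2" using n2(1) P_dvd[of m c] dvd_trans by (simp add: c_def) blast
  then have "P m dvd ?n" using n1(2) by simp
  with \<alpha> F n1(1) show ?case by (intro exI[of _ ?n] exI[of _ e]) auto
qed

end

section \<open>Consequences of minimality\<close>

context fa
begin

lemma lam_comp_fixed:
  assumes "N \<le> m" "\<And>j. N \<le> j \<Longrightarrow> j < m \<Longrightarrow> lam j (\<alpha> j) = lam1 \<or> lam j (\<alpha> j) = lamh \<zeta>"
  shows "lam_comp lam \<alpha> m \<zeta> = lam_comp lam \<alpha> N \<zeta>"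
  using assms
proof (induction m rule: dec_induct)
  case (step m)
  then have "lam m (\<alpha> m) = lam1 \<or> lam m (\<alpha> m) = lamh \<zeta>" by simp
  then have "lam m (\<alpha> m) \<zeta> = \<zeta>" by (elim disjE) (simp_all add: lam1_def lamh_def)
  then show ?case using step by simp
qed simp

lemma L_fixed:
  assumes "\<alpha> \<in> odometer p" "\<And>j. N \<le> j \<Longrightarrow> lam j (\<alpha> j) = lam1 \<or> lam j (\<alpha> j) = lamh \<zeta>"
  shows "L \<alpha> \<zeta> = lam_comp lam \<alpha> N \<zeta>"
proof (rule LIMSEQ_unique[OF L_lim[OF assms(1)]])
  have "eventually (\<lambda>m. lam_comp lam \<alpha> m \<zeta> = lam_comp lam \<alpha> N \<zeta>) sequentially"
    by (rule eventually_sequentiallyI[of N], rule lam_comp_fixed) (assumption, rule assms(2))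
  then show "(\<lambda>m. lam_comp lam \<alpha> m \<zeta>) \<longlonglongrightarrow> lam_comp lam \<alpha> N \<zeta>"
    by (rule tendsto_eventually)
qed

lemma finite_fa_Q: "finite (fa_Q p lam n)"
  by (rule finite_subset[of _ "{..<p n}"]) (auto simp: fa_Q_def)

lemma fa_Q_nonempty: "\<exists>N. \<forall>n\<ge>N. fa_Q p lam n \<noteq> {}"
proof -
  have "finite {n. fa_Q p lam n = {}}" using FA by (simp add: floyd_auslander_def)
  then obtain N where "\<forall>n\<in>{n. fa_Q p lam n = {}}. n < N" using finite_nat_set_iff_bounded by blast
  then show ?thesis by (intro exI[of _ N]) (auto simp: not_less[symmetric])
qed

text \<open>
  In a minimal system both contractions occur at infinitely many positions: otherwise, near a
  nondegenerate fibre, all degenerate fibres would sit at the same end of that fibre.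
\<close>

lemma minimal_infinite_contraction:
  assumes min: "minimal_system X T" and \<zeta>: "\<zeta> = 0 \<or> \<zeta> = 1"
  shows "infinite {n. \<exists>j<p n. lam n j = lamh \<zeta>}"
proof
  assume fin: "finite {n. \<exists>j<p n. lam n j = lamh \<zeta>}"
  then obtain N1 where "\<forall>n\<in>{n. \<exists>j<p n. lam n j = lamh \<zeta>}. n < N1"
    using finite_nat_set_iff_bounded by blast
  then have N1: "\<And>n j. j < p n \<Longrightarrow> lam n j = lamh \<zeta> \<Longrightarrow> n < N1" by blast
  obtain N2 where N2: "\<And>n. N2 \<le> n \<Longrightarrow> fa_Q p lam n \<noteq> {}" using fa_Q_nonempty by blast
  define N where "N = max N1 N2"
  have unit: "\<zeta> \<in> {0..1}" "1 - \<zeta> \<in> {0..1}" using \<zeta> by auto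
  have other: "lam j (\<delta> j) = lam1 \<or> lam j (\<delta> j) = lamh (1 - \<zeta>)"
    if "\<delta> \<in> odometer p" "N \<le> j" for \<delta> j
    using \<zeta> N1[of "\<delta> j" j] digit_less[OF that(1), of j] that(2)
    by (cases rule: lam_cases[OF digit_less[OF that(1), of j]]) (auto simp: N_def)
  define \<alpha> where "\<alpha> n = (if n < N then 0 else SOME j. j \<in> fa_Q p lam n)" for n
  have \<alpha>Q: "\<alpha> n \<in> fa_Q p lam n" if "n \<ge> N" for n
  proof -
    have "fa_Q p lam n \<noteq> {}" using N2[of n] that by (simp add: N_def)
    then show ?thesis using that by (simp add: \<alpha>_def some_in_eq)
  qed
  have "\<alpha> n < p n" for n using \<alpha>Q[of n] by (cases "n < N") (auto simp: \<alpha>_def fa_Q_def)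
  then have \<alpha>: "\<alpha> \<in> odometer p" by (simp add: odometer_def)
  have L\<alpha>: "L \<alpha> \<zeta> = lam_comp lam \<alpha> N \<zeta>"
    using \<alpha>Q by (intro L_fixed[OF \<alpha>]) (auto simp: fa_Q_def)
  have ne: "lam_comp lam \<alpha> N \<zeta> \<noteq> lam_comp lam \<alpha> N (1 - \<zeta>)"
    using lam_comp_affine[OF \<alpha>, of N 1] contr_pos[of \<alpha> N] \<zeta> by auto
  let ?x = "(\<alpha>, L \<alpha> \<zeta>)" and ?y = "(\<lambda>_. 0, L (\<lambda>_. 0) 0)"
  let ?V = "{\<delta>. \<forall>i<N. \<delta> i = \<alpha> i} \<times> (- {lam_comp lam \<alpha> N (1 - \<zeta>)})"
  have "?x \<in> X" "?y \<in> X" using \<alpha> unit zero_in_odometer by (auto intro: fa_spaceI)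
  then have cl: "?x \<in> closure {(T ^^ n) ?y | n. True}"
    using min unfolding minimal_system_def by blast
  have "open ?V" by (intro open_Times open_cylinder) (simp add: closed_def[symmetric] open_Compl)
  moreover have "?x \<in> ?V" using ne by (simp add: L\<alpha>)
  ultimately have "?V \<inter> {(T ^^ n) ?y | n. True} \<noteq> {}"
    by (subst open_Int_closure_eq_empty[symmetric]) (use cl in fast)+
  then obtain w where "w \<in> ?V \<inter> {(T ^^ n) ?y | n. True}" by (meson ex_in_conv)
  then have "w \<in> ?V" "w \<in> {(T ^^ n) ?y | n. True}" by (rule IntD1, rule IntD2)
  then obtain n where n: "(T ^^ n) ?y \<in> ?V" by (elim CollectE exE) simp
  define \<delta> where "\<delta> = shift (\<lambda>_. 0) n"
  have \<delta>: "\<delta> \<in> odometer p" by (simp add: \<delta>_def)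
  have "S (shift (\<lambda>_. 0) m) = 0" for m
  proof (induction m)
    case 0
    show ?case using infinite_zero_contracting by (simp add: shift_0[OF zero_in_odometer] S_zero_iff)
  next
    case (Suc m)
    then show ?case using S_shift_one[OF shift_in_odometer, of "\<lambda>_. 0" m] by (simp add: shift_plus)
  qed
  then have "L \<delta> 0 = L \<delta> (1 - \<zeta>)" using L_affine[OF \<delta>, of "1 - \<zeta>"] by (simp add: \<delta>_def)
  also have "\<dots> = lam_comp lam \<delta> N (1 - \<zeta>)" using other[OF \<delta>] by (intro L_fixed[OF \<delta>]) auto
  finally have L\<delta>: "L \<delta> 0 = lam_comp lam \<delta> N (1 - \<zeta>)" .
  have "(\<delta>, L \<delta> 0) \<in> ?V" using n fa_map_iter[OF zero_in_odometer, of 0 n] by (simp add: \<delta>_def)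
  then have "\<forall>i<N. \<delta> i = \<alpha> i" "L \<delta> 0 \<noteq> lam_comp lam \<alpha> N (1 - \<zeta>)" by auto
  moreover from this(1) have "lam_comp lam \<delta> N = lam_comp lam \<alpha> N" by (intro lam_comp_cong) auto
  ultimately show False using L\<delta> by simp
qed

end

section \<open>Infinitely many positions with a choice of two identities\<close>

lemma sparse_subsequence:
  fixes M :: "nat set" and h :: "nat \<Rightarrow> nat"
  assumes "infinite M"
  shows "\<exists>\<kappa> :: nat \<Rightarrow> nat. (\<forall>i. \<kappa> i \<in> M) \<and> strict_mono \<kappa> \<and> (\<forall>i j. i < j \<longrightarrow> h (\<kappa> i) < \<kappa> j)"
proof -
  have ex: "\<exists>y. y \<in> M \<and> max x (h x) < y" for x
    using assms unfolding infinite_nat_iff_unbounded by blast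
  obtain \<kappa> where \<kappa>: "\<And>i. \<kappa> i \<in> M" "\<And>i. max (\<kappa> i) (h (\<kappa> i)) < \<kappa> (Suc i)"
    using dependent_nat_choice[of "\<lambda>_ x. x \<in> M" "\<lambda>_ x y. max x (h x) < y"] ex by blast
  have mono: "strict_mono \<kappa>" using \<kappa>(2) by (simp add: strict_mono_Suc_iff)
  have "h (\<kappa> i) < \<kappa> j" if "i < j" for i j
  proof -
    have "h (\<kappa> i) < \<kappa> (Suc i)" using \<kappa>(2)[of i] by simp
    also have "\<dots> \<le> \<kappa> j" using mono that by (simp add: strict_mono_less_eq Suc_le_eq)
    finally show ?thesis .
  qed
  with \<kappa>(1) mono show ?thesis by blast
qed

text \<open>
  From position \<open>N\<close> on, the sets \<open>fa_Q p lam n\<close> are nonempty, and infinitely many of them have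
  at least two elements.
\<close>

locale fa_large = fa +
  fixes N :: nat
  assumes Q_ne: "\<And>n. N \<le> n \<Longrightarrow> fa_Q p lam n \<noteq> {}"
    and infinite_large: "infinite {n. card (fa_Q p lam n) \<ge> 2}"
begin

text \<open>
  The largest and the least digit in \<open>fa_Q\<close>.  Below \<open>N\<close>, where \<open>fa_Q\<close> may be empty, the
  digit \<open>high\<close> is set to zero.
\<close>

definition high :: "nat \<Rightarrow> nat" where "high n = (if n < N then 0 else Max (fa_Q p lam n))"

definition low :: "nat \<Rightarrow> nat" where "low n = Min (fa_Q p lam n)"

text \<open>The elements whose digits are \<open>low\<close> at the positions in \<open>B\<close> and \<open>high\<close> elsewhere.\<close>

definition switch :: "nat set \<Rightarrow> nat \<Rightarrow> nat" where "switch B n = (if n \<in> B then low n else high n)"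

text \<open>
  Adding \<open>step k\<close> turns the digit \<open>low k\<close> into \<open>high k\<close>.  Added to the digit \<open>high k\<close>, it causes
  a contraction, first at position \<open>exit k\<close>, because digits greater than \<open>high\<close> are not in \<open>fa_Q\<close>.
\<close>

definition step :: "nat \<Rightarrow> nat" where "step k = (high k - low k) * P k"

definition exit :: "nat \<Rightarrow> nat" where
  "exit k = (LEAST m. N \<le> m \<and> lam m (shift high (step k) m) \<noteq> lam1)"

text \<open>The positions at which the identity can be chosen in two ways.\<close>

definition large :: "nat set" where "large = {k. N \<le> k \<and> low k < high k}"

lemma high_Q: "N \<le> n \<Longrightarrow> high n \<in> fa_Q p lam n"
  using Max_in[OF finite_fa_Q Q_ne] by (simp add: high_def)

lemma low_Q: "N \<le> n \<Longrightarrow> low n \<in> fa_Q p lam n"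
  using Min_in[OF finite_fa_Q Q_ne] by (simp add: low_def)

lemma high_max: "N \<le> n \<Longrightarrow> j \<in> fa_Q p lam n \<Longrightarrow> j \<le> high n"
  using Max_ge[OF finite_fa_Q] by (simp add: high_def)

lemma lam_high: "N \<le> n \<Longrightarrow> lam n (high n) = lam1" and high_less: "N \<le> n \<Longrightarrow> high n < p n"
  using high_Q[of n] by (auto simp: fa_Q_def)

lemma high_in_odometer: "high \<in> odometer p"
  using high_less by (auto simp: odometer_def high_def)

lemma infinite_large_set: "infinite large"
proof -
  have "{n. card (fa_Q p lam n) \<ge> 2} \<subseteq> {..<N} \<union> large"
  proof
    fix n assume "n \<in> {n. card (fa_Q p lam n) \<ge> 2}"
    then have c: "card (fa_Q p lam n) \<ge> 2" by simp
    show "n \<in> {..<N} \<union> large"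
    proof (cases "n < N")
      case False
      have "low n \<noteq> high n"
      proof
        assume "low n = high n"
        then have "fa_Q p lam n \<subseteq> {high n}"
          using high_max[of n] False Min_le[OF finite_fa_Q, of _ n] by (force simp: low_def)
        then have "card (fa_Q p lam n) \<le> 1" using card_mono[of "{high n}" "fa_Q p lam n"] by simp
        with c show False by simp
      qed
      moreover have "low n \<le> high n" using high_max[OF _ low_Q] False by simp
      ultimately show ?thesis using False by (simp add: large_def)
    qed simp
  qed
  then show ?thesis using infinite_large finite_subset by blast
qed

lemma step_pos: "k \<in> large \<Longrightarrow> step k \<ge> 1"
  by (simp add: large_def step_def Suc_le_eq)

lemma P_dvd_step: "P k dvd step k"
  by (simp add: step_def)

text \<open>
  Otherwise all digits of the sum would be at most those of \<open>high\<close>, although its value is greater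
  and no carry gets lost.
\<close>

lemma exit_exists:
  assumes k: "k \<in> large"
  shows "\<exists>m\<ge>N. lam m (shift high (step k) m) \<noteq> lam1"
proof (rule ccontr)
  assume "\<not> ?thesis"
  then have id: "lam m (shift high (step k) m) = lam1" if "m \<ge> N" for m using that by blast
  have kN: "N \<le> k" using k by (simp add: large_def)
  have le: "shift high (step k) m \<le> high m" for m
  proof (cases "m < N")
    case True
    then show ?thesis using shift_low[OF high_in_odometer P_dvd_step, of m k] kN by simp
  next
    case False
    then show ?thesis using id[of m] digit_less[OF shift_in_odometer, of high "step k" m]
      by (intro high_max) (auto simp: fa_Q_def)
  qed
  \<comment> \<open>Where the last digit is a contraction, \<open>high\<close> is not the last digit and absorbs a carry.\<close>
  have "infinite {n. lam n (p n - 1) \<in> {lam0, lam2}}" using FA by (simp add: floyd_auslander_def)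
  then obtain l where l: "l > k" "lam l (p l - 1) \<in> {lam0, lam2}"
    unfolding infinite_nat_iff_unbounded by blast
  then have "lam l (p l - 1) \<noteq> lam1" using lamh_neq_lam1 by (auto simp: lam0_eq lam2_eq)
  then have "high l \<noteq> p l - 1" using lam_high[of l] l kN by auto
  then have room: "high l + 2 \<le> p l" using high_less[of l] l kN by simp
  have "step k < P l"
  proof -
    have "step k \<le> high k * P k" by (simp add: step_def)
    also have "\<dots> < p k * P k" using high_less[OF kN] by simp
    also have "\<dots> \<le> P l" using P_mono[of "Suc k" l] l by (simp add: P_Suc)
    finally show ?thesis .
  qed
  then have "val high (Suc l) + step k < P l + high l * P l + P l"
    using val_less[OF high_in_odometer, of l] by (simp add: val_Suc)
  also have "\<dots> = (high l + 2) * P l" by simp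
  also have "\<dots> \<le> P (Suc l)" unfolding P_Suc using room by (intro mult_right_mono) auto
  finally have "val (shift high (step k)) (Suc l) = val high (Suc l) + step k" by (simp add: val_shift)
  moreover have "val (shift high (step k)) (Suc l) \<le> val high (Suc l)"
    unfolding val_def using le by (intro sum_mono mult_right_mono) auto
  ultimately show False using step_pos[OF k] by simp
qed

lemma exit_first:
  assumes "k \<in> large"
  shows "N \<le> exit k" "lam (exit k) (shift high (step k) (exit k)) \<noteq> lam1" "k \<le> exit k"
    and "\<And>j. N \<le> j \<Longrightarrow> j < exit k \<Longrightarrow> lam j (shift high (step k) j) = lam1"
proof -
  have "\<exists>m. N \<le> m \<and> lam m (shift high (step k) m) \<noteq> lam1" using exit_exists[OF assms] by blast
  from LeastI_ex[OF this, folded exit_def]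
  show e: "N \<le> exit k" "lam (exit k) (shift high (step k) (exit k)) \<noteq> lam1" by auto
  show "k \<le> exit k"
  proof (rule ccontr)
    assume "\<not> k \<le> exit k"
    then have "shift high (step k) (exit k) = high (exit k)"
      using shift_low[OF high_in_odometer P_dvd_step] by simp
    then show False using e lam_high by simp
  qed
  show "lam j (shift high (step k) j) = lam1" if "N \<le> j" "j < exit k" for j
    using not_less_Least[of j "\<lambda>m. N \<le> m \<and> lam m (shift high (step k) m) \<noteq> lam1"] that
    by (auto simp: exit_def)
qed

lemma switch_in_odometer: "B \<subseteq> large \<Longrightarrow> switch B \<in> odometer p"
  using low_Q high_in_odometer by (fastforce simp: odometer_def switch_def fa_Q_def large_def)

lemma lam_switch: "N \<le> j \<Longrightarrow> lam j (switch B j) = lam1"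
  using low_Q[of j] lam_high[of j] by (auto simp: switch_def fa_Q_def)

lemma switch_below: "B \<subseteq> large \<Longrightarrow> j < N \<Longrightarrow> switch B j = high j"
  by (auto simp: switch_def large_def)

text \<open>
  The fibre over \<open>switch B\<close> is the image of the unit interval under this affine map, for every set
  \<open>B\<close> of positions in \<open>large\<close>.
\<close>

definition A :: "real \<Rightarrow> real" where "A = lam_comp lam high N"

lemma A_dist: "\<bar>A u - A v\<bar> = contr high N * \<bar>u - v\<bar>"
proof -
  have "A u - A v = contr high N * (u - v)"
    unfolding A_def using lam_comp_affine[OF high_in_odometer, of N u] lam_comp_affine[OF high_in_odometer, of N v]
    by (simp add: algebra_simps)
  then show ?thesis using contr_pos[of high N] by (simp add: abs_mult)
qed

lemma L_switch:
  assumes "B \<subseteq> large" shows "L (switch B) z = A z"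
proof -
  have "lam j (switch B j) = lam1 \<or> lam j (switch B j) = lamh z" if "N \<le> j" for j
    using lam_switch[OF that] by blast
  then have "L (switch B) z = lam_comp lam (switch B) N z"
    by (rule L_fixed[OF switch_in_odometer[OF assms]])
  also have "lam_comp lam (switch B) N = A" 
    unfolding A_def using switch_below[OF assms] by (rule lam_comp_cong)
  finally show ?thesis .
qed

lemma shift_switch_in:
  assumes "B \<subseteq> large" "k \<in> B"
  shows "shift (switch B) (step k) = switch (B - {k})"
proof -
  have k: "N \<le> k" "low k < high k" using assms by (auto simp: large_def)
  then have *: "switch B k + (high k - low k) = high k" using assms(2) by (simp add: switch_def)
  then have "shift (switch B) (step k) = (switch B)(k := high k)"
    unfolding step_def using shift_digit[OF switch_in_odometer[OF assms(1)], of k "high k - low k"]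
      high_less[OF k(1)] by simp
  also have "\<dots> = switch (B - {k})" by (auto simp: switch_def)
  finally show ?thesis .
qed

lemma L_switch_out:
  assumes B: "B \<subseteq> large" and k: "k \<in> large" "k \<notin> B"
    and gap: "\<And>b. b \<in> B \<Longrightarrow> k < b \<Longrightarrow> exit k < b"
    and n: "P (Suc (exit k)) dvd n" and z: "z \<in> {0..1}"
  shows "\<exists>w\<in>{0..1}. L (shift (switch B) (step k + n)) z = A (lam (exit k) (shift high (step k) (exit k)) w)"
proof -
  define \<delta> where "\<delta> = shift (switch B) (step k + n)"
  have \<delta>: "\<delta> \<in> odometer p" by (simp add: \<delta>_def)
  have sB: "switch B \<in> odometer p" using B by (rule switch_in_odometer)
  have kN: "N \<le> k" using k by (simp add: large_def)
  have dig: "\<delta> j = shift (switch B) (step k) j" if "j \<le> exit k" for j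
    unfolding \<delta>_def shift_plus[symmetric] using that by (intro shift_low[OF shift_in_odometer n]) simp
  have dig1: "\<delta> j = switch B j" if "j < k" for j
    using dig[of j] exit_first(3)[OF k(1)] that shift_low[OF sB P_dvd_step that] by simp
  have dig2: "\<delta> j = shift high (step k) j" if "k \<le> j" "j \<le> exit k" for j
  proof -
    have "shift (switch B) (step k) j = shift high (step k) j"
    proof (rule shift_tail_cong[OF sB high_in_odometer P_dvd_step that(1)])
      fix i assume "k \<le> i" "i \<le> j"
      then have "i \<notin> B" using gap[of i] k(2) that(2) by (cases "i = k") auto
      then show "switch B i = high i" by (simp add: switch_def)
    qed
    then show ?thesis using dig[OF that(2)] by simp
  qed
  have id: "lam j (\<delta> j) = lam1" if "N \<le> j" "j < exit k" for j
    using lam_switch[OF that(1), of B] dig1[of j] dig2[of j] exit_first(4)[OF k(1) that] that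
    by (cases "j < k") auto
  obtain w where w: "w \<in> {0..1}" "L \<delta> z = lam_comp lam \<delta> (Suc (exit k)) w"
    using L_split[OF \<delta> z] by blast
  let ?v = "lam (exit k) (shift high (step k) (exit k)) w"
  have "L \<delta> z = lam_comp lam \<delta> (exit k) ?v"
    using w(2) dig2[of "exit k"] exit_first(3)[OF k(1)] by simp
  also have "\<dots> = lam_comp lam \<delta> N ?v"
    using id by (intro lam_comp_fixed[OF exit_first(1)[OF k(1)]]) blast
  also have "lam_comp lam \<delta> N = A"
    unfolding A_def using dig1 switch_below[OF B] kN by (intro lam_comp_cong) auto
  finally show ?thesis using w(1) unfolding \<delta>_def by blast
qed

text \<open>
  Infinitely many positions at which the contraction caused by \<open>step\<close> is always the same one;
  \<open>\<zeta>\<close> is the endpoint that is not its fixed point.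
\<close>

lemma uniform_exit:
  obtains M \<zeta> where "infinite M" "M \<subseteq> large" "\<zeta> = 0 \<or> \<zeta> = 1"
    "\<And>k w. k \<in> M \<Longrightarrow> w \<in> {0..1} \<Longrightarrow> \<bar>lam (exit k) (shift high (step k) (exit k)) w - \<zeta>\<bar> \<ge> 1/2"
proof -
  let ?t = "\<lambda>k. lam (exit k) (shift high (step k) (exit k))"
  have "?t k = lamh 0 \<or> ?t k = lamh 1" if "k \<in> large" for k
    using exit_first(2)[OF that] lam_cases[OF digit_less[OF shift_in_odometer]] by blast
  then have "large \<subseteq> {k \<in> large. ?t k = lamh 0} \<union> {k \<in> large. ?t k = lamh 1}" by blast
  then have "infinite {k \<in> large. ?t k = lamh 0} \<or> infinite {k \<in> large. ?t k = lamh 1}"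
    using infinite_large_set finite_subset by blast
  then show thesis
  proof
    assume "infinite {k \<in> large. ?t k = lamh 0}"
    then show thesis by (rule that[where \<zeta> = 1]) (auto simp: lamh_def)
  next
    assume "infinite {k \<in> large. ?t k = lamh 1}"
    then show thesis by (rule that[where \<zeta> = 0]) (auto simp: lamh_def)
  qed
qed

subsection \<open>Nontameness\<close>

lemma nontame_large: "nontame X T"
proof -
  obtain M \<zeta> where M: "infinite M" "M \<subseteq> large" and \<zeta>: "\<zeta> = 0 \<or> \<zeta> = 1"
    and far: "\<And>k w. k \<in> M \<Longrightarrow> w \<in> {0..1} \<Longrightarrow> \<bar>lam (exit k) (shift high (step k) (exit k)) w - \<zeta>\<bar> \<ge> 1/2"
    by (rule uniform_exit) blast
  obtain \<kappa> :: "nat \<Rightarrow> nat" where \<kappa>: "\<And>i. \<kappa> i \<in> M" "strict_mono \<kappa>" "\<And>i j. i < j \<Longrightarrow> exit (\<kappa> i) < \<kappa> j"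
    using sparse_subsequence[OF M(1), of exit] by blast
  have large: "\<kappa> ` I \<subseteq> large" for I using \<kappa>(1) M(2) by blast
  have \<zeta>u: "\<zeta> \<in> {0..1}" using \<zeta> by auto
  define x where "x I = (switch (\<kappa> ` I), L (switch (\<kappa> ` I)) \<zeta>)" for I
  let ?C = "{w :: (nat \<Rightarrow> nat) \<times> real. snd w = A \<zeta>}"
  let ?D = "{w :: (nat \<Rightarrow> nat) \<times> real. contr high N / 2 \<le> \<bar>snd w - A \<zeta>\<bar>}"
  have iter: "(T ^^ n) (x I) = (shift (switch (\<kappa> ` I)) n, L (shift (switch (\<kappa> ` I)) n) \<zeta>)" for n I
    unfolding x_def by (rule fa_map_iter[OF switch_in_odometer[OF large] \<zeta>u])
  show ?thesis
  proof (rule nontame_if_separated[where n = "\<lambda>i. step (\<kappa> i)" and x = x and C = "\<lambda>_. ?C" and D = "\<lambda>_. ?D"])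
    have "(euclidean :: nat topology) = discrete_topology UNIV"
      by (rule sym) (simp add: discrete_topology_unique open_discrete)
    then have "regular_space (product_topology (\<lambda>_ :: nat. euclidean :: nat topology) UNIV)"
      by (simp add: regular_space_product_topology)
    then have "regular_space (euclidean :: (nat \<Rightarrow> nat) topology)"
      by (simp add: euclidean_product_topology)
    then show "regular_space (euclidean :: ((nat \<Rightarrow> nat) \<times> real) topology)"
      by (simp add: regular_space_prod_topology regular_space_euclidean flip: prod_topology_euclidean)
    show "x I \<in> X" for I
      unfolding x_def by (rule fa_spaceI[OF switch_in_odometer[OF large] \<zeta>u])
    show "step (\<kappa> i) \<ge> 1" for i using step_pos M(2) \<kappa>(1) by blast
    show "closed ?C" by (intro closed_Collect_eq continuous_intros)
    show "closed ?D" by (intro closed_Collect_le continuous_intros)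
    show "?C \<inter> ?D = {}" using contr_pos[of high N] by auto
    show "(T ^^ step (\<kappa> i)) (x I) \<in> ?C" if "i \<in> I" for i I
    proof -
      have "shift (switch (\<kappa> ` I)) (step (\<kappa> i)) = switch (\<kappa> ` I - {\<kappa> i})"
        using that by (intro shift_switch_in large) auto
      moreover have "\<kappa> ` I - {\<kappa> i} \<subseteq> large" using large by blast
      ultimately show ?thesis by (simp add: iter L_switch)
    qed
    show "(T ^^ step (\<kappa> i)) (x I) \<in> ?D" if "i \<notin> I" for i I
    proof -
      have "\<kappa> i \<notin> \<kappa> ` I" using that strict_mono_eq[OF \<kappa>(2)] by auto
      moreover have "exit (\<kappa> i) < b" if "b \<in> \<kappa> ` I" "\<kappa> i < b" for b
        using that \<kappa>(3) strict_mono_less[OF \<kappa>(2)] by auto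
      ultimately obtain w where "w \<in> {0..1}"
        "L (shift (switch (\<kappa> ` I)) (step (\<kappa> i) + 0)) \<zeta>
          = A (lam (exit (\<kappa> i)) (shift high (step (\<kappa> i)) (exit (\<kappa> i))) w)"
        using L_switch_out[OF large _ _ _ _ \<zeta>u, of "\<kappa> i" I 0] M(2) \<kappa>(1) by blast
      moreover from this(1) have "1/2 \<le> \<bar>lam (exit (\<kappa> i)) (shift high (step (\<kappa> i)) (exit (\<kappa> i))) w - \<zeta>\<bar>"
        using far \<kappa>(1) by blast
      ultimately show ?thesis
        using contr_pos[of high N] mult_left_mono[of "1/2" _ "contr high N"] by (simp add: iter A_dist)
    qed
  qed (rule compact_fa_space fa_map_into)+
qed

end

section \<open>Many minimal idempotents\<close>

context fa_large
begin

text \<open>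
  A natural number that steers all elements \<open>switch B\<close> with \<open>B\<close> disjoint from \<open>{c..<e}\<close>
  through contractions towards \<open>\<zeta>\<close>, whatever is added at the positions from \<open>e\<close> on.
\<close>

lemma steer_to_endpoint:
  assumes Nc: "N \<le> c" and ce: "c \<le> e" and \<zeta>: "\<zeta> \<in> {0..1}"
    and k: "k \<le> card ({n. \<exists>j<p n. lam n j = lamh \<zeta>} \<inter> {c..<e})"
  shows "\<exists>n\<ge>1. P c dvd n \<and> (\<forall>B m. B \<subseteq> large \<longrightarrow> B \<inter> {c..<e} = {} \<longrightarrow> P e dvd m \<longrightarrow>
    \<bar>L (shift (switch B) (n + m)) 0 - A \<zeta>\<bar> \<le> (1/2) ^ k)"
proof -
  let ?Z = "{n. \<exists>j<p n. lam n j = lamh \<zeta>}"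
  define w where "w n = (if n \<in> ?Z \<inter> {c..<e} then SOME j. j < p n \<and> lam n j = lamh \<zeta> else high n)" for n
  have wZ: "w n < p n \<and> lam n (w n) = lamh \<zeta>" if n: "n \<in> ?Z \<inter> {c..<e}" for n
  proof -
    have "\<exists>j. j < p n \<and> lam n j = lamh \<zeta>" using n by blast
    from someI_ex[OF this] show ?thesis using n by (simp add: w_def)
  qed
  have w: "w \<in> odometer p"
    using wZ digit_less[OF high_in_odometer] by (fastforce simp: odometer_def w_def)
  have "w i = high i" if "i < c" for i using that by (simp add: w_def)
  then obtain n where n: "n \<ge> 1" "P c dvd n" "\<And>j. j < e \<Longrightarrow> shift high n j = w j"
    using shift_steer[OF high_in_odometer w ce] by blast
  have "\<bar>L (shift (switch B) (n + m)) 0 - A \<zeta>\<bar> \<le> (1/2) ^ k"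
    if B: "B \<subseteq> large" "B \<inter> {c..<e} = {}" and m: "P e dvd m" for B m
  proof -
    define \<delta> where "\<delta> = shift (switch B) (n + m)"
    have \<delta>: "\<delta> \<in> odometer p" by (simp add: \<delta>_def)
    note sB = switch_in_odometer[OF B(1)]
    have dig: "\<delta> j = shift (switch B) n j" if "j < e" for j
      unfolding \<delta>_def shift_plus[symmetric] by (rule shift_low[OF shift_in_odometer m that])
    have dig1: "\<delta> j = switch B j" if "j < c" for j
      using dig[of j] shift_low[OF sB n(2) that] that ce by simp
    have dig2: "\<delta> j = w j" if j: "c \<le> j" "j < e" for j
    proof -
      have "shift (switch B) n j = shift high n j"
      proof (rule shift_tail_cong[OF sB high_in_odometer n(2) j(1)])
        fix i assume "c \<le> i" "i \<le> j"
        then have "i \<notin> B" using B(2) j(2) by auto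
        then show "switch B i = high i" by (simp add: switch_def)
      qed
      then show ?thesis using dig n(3) j(2) by simp
    qed
    have maps: "lam j (\<delta> j) = lam1 \<or> lam j (\<delta> j) = lamh \<zeta>" if "N \<le> j" "j < e" for j
    proof (cases "j < c")
      case True
      then show ?thesis using lam_switch[OF that(1)] dig1 by simp
    next
      case False
      then show ?thesis using dig2[of j] wZ[of j] lam_high[OF that(1)] that(2)
        by (cases "j \<in> ?Z \<inter> {c..<e}") (auto simp: w_def)
    qed
    have "lam_comp lam \<delta> N = A"
      unfolding A_def using dig1 switch_below[OF B(1)] Nc by (intro lam_comp_cong) auto
    then have A: "A \<zeta> = lam_comp lam \<delta> e \<zeta>"
      using lam_comp_fixed[of N e \<delta> \<zeta>] maps Nc ce by simp
    obtain u where u: "u \<in> {0..1}" "L \<delta> 0 = lam_comp lam \<delta> e u" using L_split[OF \<delta>, of 0 e] by auto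
    have "L \<delta> 0 - A \<zeta> = contr \<delta> e * (u - \<zeta>)"
      unfolding A u(2) using lam_comp_affine[OF \<delta>, of e u] lam_comp_affine[OF \<delta>, of e \<zeta>]
      by (simp add: algebra_simps)
    then have "\<bar>L \<delta> 0 - A \<zeta>\<bar> = contr \<delta> e * \<bar>u - \<zeta>\<bar>"
      using contr_pos[of \<delta> e] by (simp add: abs_mult)
    also have "\<dots> \<le> contr \<delta> e * 1"
      using u(1) \<zeta> contr_pos[of \<delta> e] by (intro mult_left_mono) (auto simp: abs_le_iff)
    also have "contr \<delta> e \<le> (1/2) ^ card (?Z \<inter> {c..<e})"
    proof (rule contr_le_power)
      show "?Z \<inter> {c..<e} \<subseteq> {j. j < e \<and> lam j (\<delta> j) \<noteq> lam1}"
      proof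
        fix j assume j: "j \<in> ?Z \<inter> {c..<e}"
        then have "\<delta> j = w j" using dig2 by simp
        then show "j \<in> {j. j < e \<and> lam j (\<delta> j) \<noteq> lam1}"
          using wZ[OF j] j lamh_neq_lam1 by simp
      qed
    qed
    also have "\<dots> \<le> (1/2) ^ k" using k by (intro power_decreasing) auto
    finally show ?thesis by (simp add: \<delta>_def)
  qed
  with n(1,2) show ?thesis by blast
qed

text \<open>
  For every set \<open>R\<close> of sets of natural numbers, some positive multiple \<open>n\<close> of \<open>P K\<close> brings the
  left end of the fibre over \<open>switch (\<kappa> ` indep x)\<close> close to \<open>A \<zeta>\<close> if \<open>x \<in> R\<close> and keeps it away
  from there if \<open>x \<notin> R\<close>, for finitely many \<open>x\<close>, and contracts finitely many prescribed fibres.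
  It is the sum of a step, of a number steering to \<open>\<zeta>\<close> and of a contracting one, which act at
  higher and higher positions.
\<close>

lemma simultaneous_approximation:
  fixes \<kappa> :: "nat \<Rightarrow> nat"
  assumes \<zeta>: "\<zeta> \<in> {0..1}"
    and \<kappa>: "\<And>i. \<kappa> i \<in> large" "strict_mono \<kappa>" "\<And>i j. i < j \<Longrightarrow> e (\<kappa> i) < \<kappa> j"
    and far: "\<And>i w. w \<in> {0..1} \<Longrightarrow>
      \<bar>lam (exit (\<kappa> i)) (shift high (step (\<kappa> i)) (exit (\<kappa> i))) w - \<zeta>\<bar> \<ge> 1/2"
    and e: "\<And>k. Suc (exit k) \<le> e k"
      "\<And>k. k \<le> card ({n. \<exists>j<p n. lam n j = lamh \<zeta>} \<inter> {Suc (exit k)..<e k})"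
    and F: "finite F" "F \<subseteq> odometer p" and \<Phi>: "finite \<Phi>"
  shows "\<exists>n\<ge>1. P K dvd n \<and> (\<forall>\<alpha>\<in>F. S (shift \<alpha> n) \<le> (1/2) ^ K) \<and>
    (\<forall>x\<in>\<Phi>. if x \<in> R then \<bar>L (shift (switch (\<kappa> ` indep x)) n) 0 - A \<zeta>\<bar> \<le> (1/2) ^ K
      else contr high N / 2 \<le> \<bar>L (shift (switch (\<kappa> ` indep x)) n) 0 - A \<zeta>\<bar>)"
proof -
  obtain i where i: "i \<ge> K" "\<And>x. x \<in> \<Phi> \<Longrightarrow> i \<in> indep x \<longleftrightarrow> x \<in> R"
    using indep_pattern[OF \<Phi>, of K R] by blast
  define k where "k = \<kappa> i"
  have k: "k \<in> large" using \<kappa>(1) by (simp add: k_def)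
  have Kk: "K \<le> k" using i(1) seq_suble[OF \<kappa>(2), of i] by (simp add: k_def)
  let ?c = "Suc (exit k)"
  have kc: "k \<le> ?c" "N \<le> ?c" using exit_first(1,3)[OF k] by auto
  have large: "\<kappa> ` I \<subseteq> large" for I using \<kappa>(1) by blast
  have gap: "e k < b" if "b \<in> \<kappa> ` I" "k < b" for b I
    using that \<kappa>(3) strict_mono_less[OF \<kappa>(2)] by (auto simp: k_def)
  have kI: "k \<in> \<kappa> ` I \<longleftrightarrow> i \<in> I" for I
    using strict_mono_eq[OF \<kappa>(2)] by (auto simp: k_def)
  obtain n2 where n2: "P ?c dvd n2"
    "\<And>B m. B \<subseteq> large \<Longrightarrow> B \<inter> {?c..<e k} = {} \<Longrightarrow> P (e k) dvd m \<Longrightarrow>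
      \<bar>L (shift (switch B) (n2 + m)) 0 - A \<zeta>\<bar> \<le> (1/2) ^ k"
    using steer_to_endpoint[OF kc(2) e(1) \<zeta> e(2)] by blast
  let ?F = "(\<lambda>\<alpha>. shift \<alpha> (step k + n2)) ` F"
  obtain n3 M where n3: "P (e k) dvd n3" "\<forall>\<alpha>\<in>?F. contr (shift \<alpha> n3) M \<le> (1/2) ^ K"
  proof -
    have "finite ?F" "?F \<subseteq> odometer p" using F(1) by auto
    then show thesis using contract_finitely_many[of ?F "e k" K] that by blast
  qed
  define n where "n = step k + (n2 + n3)"
  have "n \<ge> 1" using step_pos[OF k] by (simp add: n_def)
  moreover have "P K dvd n"
  proof -
    have "P K dvd step k" "P K dvd n2" "P K dvd n3"
      using dvd_trans[OF P_dvd[OF Kk] P_dvd_step] dvd_trans[OF P_dvd n2(1), of K]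
        dvd_trans[OF P_dvd n3(1), of K] Kk kc(1) e(1)[of k] by auto
    then show ?thesis by (simp add: n_def)
  qed
  moreover have "S (shift \<alpha> n) \<le> (1/2) ^ K" if "\<alpha> \<in> F" for \<alpha>
    using n3(2) that S_le_contr[of "shift \<alpha> n" M] by (auto simp: n_def shift_plus add.assoc)
  moreover have "\<bar>L (shift (switch (\<kappa> ` indep x)) n) 0 - A \<zeta>\<bar> \<le> (1/2) ^ K" if x: "x \<in> \<Phi>" "x \<in> R" for x
  proof -
    let ?B = "\<kappa> ` indep x - {k}"
    have "k \<in> \<kappa> ` indep x" using i(2) x kI by blast
    then have "shift (switch (\<kappa> ` indep x)) (step k) = switch ?B"
      by (rule shift_switch_in[OF large])
    then have "shift (switch (\<kappa> ` indep x)) n = shift (switch ?B) (n2 + n3)"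
      by (simp add: n_def flip: shift_plus)
    moreover have "?B \<subseteq> large" using large by blast
    moreover have "?B \<inter> {?c..<e k} = {}" using gap[of _ "indep x"] kc(1) by fastforce
    ultimately have "\<bar>L (shift (switch (\<kappa> ` indep x)) n) 0 - A \<zeta>\<bar> \<le> (1/2) ^ k"
      using n2(2)[of ?B n3] n3(1) by simp
    also have "\<dots> \<le> (1/2) ^ K" using Kk by (intro power_decreasing) auto
    finally show ?thesis .
  qed
  moreover have "contr high N / 2 \<le> \<bar>L (shift (switch (\<kappa> ` indep x)) n) 0 - A \<zeta>\<bar>"
    if x: "x \<in> \<Phi>" "x \<notin> R" for x
  proof -
    have "k \<notin> \<kappa> ` indep x" using i(2) x kI by blast
    moreover have "exit k < b" if "b \<in> \<kappa> ` indep x" "k < b" for b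
      using gap[OF that] e(1)[of k] by simp
    moreover have "P ?c dvd n2 + n3"
      using n2(1) dvd_trans[OF P_dvd[OF e(1)] n3(1)] by simp
    ultimately obtain w where w: "w \<in> {0..1}"
      "L (shift (switch (\<kappa> ` indep x)) n) 0 = A (lam (exit k) (shift high (step k) (exit k)) w)"
      using L_switch_out[OF large k, of "indep x" "n2 + n3" 0] unfolding n_def by auto
    show ?thesis
      using far[OF w(1), of i] contr_pos[of high N] mult_left_mono[of "1/2" _ "contr high N"]
      by (simp add: w(2) A_dist k_def)
  qed
  ultimately show ?thesis by (intro exI[of _ n]) auto
qed

lemma many_minimal_idempotents:
  assumes min: "minimal_system X T"
  shows "(UNIV :: nat set set set) \<lesssim> minimal_idempotents X T"
proof -
  obtain M \<zeta> where M: "infinite M" "M \<subseteq> large" and \<zeta>: "\<zeta> = 0 \<or> \<zeta> = 1"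
    and far: "\<And>k w. k \<in> M \<Longrightarrow> w \<in> {0..1} \<Longrightarrow> \<bar>lam (exit k) (shift high (step k) (exit k)) w - \<zeta>\<bar> \<ge> 1/2"
    by (rule uniform_exit) blast
  have \<zeta>u: "\<zeta> \<in> {0..1}" using \<zeta> by auto
  have "\<exists>e. Suc (exit k) \<le> e \<and> k \<le> card ({n. \<exists>j<p n. lam n j = lamh \<zeta>} \<inter> {Suc (exit k)..<e})" for k
    using infinite_card_ge[OF minimal_infinite_contraction[OF min \<zeta>]] by blast
  then have "\<exists>e. \<forall>k. Suc (exit k) \<le> e k \<and>
      k \<le> card ({n. \<exists>j<p n. lam n j = lamh \<zeta>} \<inter> {Suc (exit k)..<e k})"
    by (intro choice allI)
  then obtain e where e: "\<And>k. Suc (exit k) \<le> e k"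
    "\<And>k. k \<le> card ({n. \<exists>j<p n. lam n j = lamh \<zeta>} \<inter> {Suc (exit k)..<e k})" by blast
  obtain \<kappa> :: "nat \<Rightarrow> nat" where \<kappa>: "\<And>i. \<kappa> i \<in> M" "strict_mono \<kappa>" "\<And>i j. i < j \<Longrightarrow> e (\<kappa> i) < \<kappa> j"
    using sparse_subsequence[OF M(1), of e] by blast
  have \<kappa>l: "\<kappa> i \<in> large" for i using \<kappa>(1) M(2) by blast
  define \<sigma> where "\<sigma> x = switch (\<kappa> ` indep x)" for x
  have \<sigma>: "\<sigma> x \<in> odometer p" for x
    unfolding \<sigma>_def using \<kappa>l by (intro switch_in_odometer) blast
  define x0 where "x0 x = (\<sigma> x, L (\<sigma> x) 0)" for x
  have "\<exists>f\<in>minimal_idempotents X T. \<forall>x. x \<in> R \<longleftrightarrow> snd (f (x0 x)) = A \<zeta>" for R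
  proof -
    define d where "d x n = \<bar>L (shift (\<sigma> x) n) 0 - A \<zeta>\<bar>" for x n
    define C where "C = (\<lambda>(F, \<Phi>, K). {n. n \<ge> 1 \<and> P K dvd n \<and> (\<forall>\<alpha>\<in>F. S (shift \<alpha> n) \<le> (1/2) ^ K) \<and>
      (\<forall>x\<in>\<Phi>. if x \<in> R then d x n \<le> (1/2) ^ K else contr high N / 2 \<le> d x n)})"
    let ?I = "{F. finite F \<and> F \<subseteq> odometer p} \<times> Collect finite \<times> (UNIV :: nat set)"
    have "\<exists>U\<in>nat_ultrafilters. \<forall>D\<in>C ` ?I. eventually (\<lambda>n. n \<in> D) U"
    proof (rule ultrafilter_of_base)
      have "\<exists>n. n \<in> C (F, \<Phi>, K)" if "finite F" "F \<subseteq> odometer p" "finite \<Phi>" for F \<Phi> K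
        using simultaneous_approximation[OF \<zeta>u \<kappa>l \<kappa>(2,3) far[OF \<kappa>(1)] e that, of K R]
        by (simp only: C_def d_def \<sigma>_def prod.case mem_Collect_eq)
      then have "C (F, \<Phi>, K) \<noteq> {}" if "finite F" "F \<subseteq> odometer p" "finite \<Phi>" for F \<Phi> K
        using that by blast
      then show "{} \<notin> C ` ?I" by auto
      show "C ` ?I \<noteq> {}" by blast
      fix D1 D2 assume "D1 \<in> C ` ?I" "D2 \<in> C ` ?I"
      then obtain t1 t2 where t: "t1 \<in> ?I" "t2 \<in> ?I" "D1 = C t1" "D2 = C t2" by blast
      obtain F1 \<Phi>1 K1 where t1: "t1 = (F1, \<Phi>1, K1)" by (rule prod_cases3)
      obtain F2 \<Phi>2 K2 where t2: "t2 = (F2, \<Phi>2, K2)" by (rule prod_cases3)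
      note i = t(1,2)[unfolded t1 t2] and D = t(3,4)[unfolded t1 t2]
      have anti: "C (F', \<Phi>', K') \<subseteq> C (F, \<Phi>, K)" if "F \<subseteq> F'" "\<Phi> \<subseteq> \<Phi>'" "K \<le> K'" for F F' \<Phi> \<Phi>' K K'
      proof
        fix n assume n: "n \<in> C (F', \<Phi>', K')"
        have pow: "y \<le> (1/2) ^ K" if "y \<le> (1/2) ^ K'" for y :: real
          by (rule order_trans[OF that power_decreasing[OF \<open>K \<le> K'\<close>]]) auto
        have "P K dvd n" using n P_dvd[OF \<open>K \<le> K'\<close>] dvd_trans by (auto simp: C_def)
        then show "n \<in> C (F, \<Phi>, K)"
          using n that(1,2) by (auto simp: C_def split: if_splits intro!: pow)
      qed
      show "\<exists>D\<in>C ` ?I. D \<subseteq> D1 \<inter> D2"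
      proof
        show "C (F1 \<union> F2, \<Phi>1 \<union> \<Phi>2, max K1 K2) \<in> C ` ?I" using i by (intro imageI) auto
        show "C (F1 \<union> F2, \<Phi>1 \<union> \<Phi>2, max K1 K2) \<subseteq> D1 \<inter> D2"
          unfolding D by (intro Int_greatest anti) auto
      qed
    qed
    then obtain U where U: "U \<in> nat_ultrafilters"
      and ev: "\<And>F \<Phi> K. finite F \<Longrightarrow> F \<subseteq> odometer p \<Longrightarrow> finite \<Phi> \<Longrightarrow> eventually (\<lambda>n. n \<in> C (F, \<Phi>, K)) U"
      by auto
    have nb: "U \<noteq> bot" using U by (simp add: nat_ultrafilters_def)
    have "\<exists>f\<in>minimal_idempotents X T. \<forall>\<alpha>\<in>odometer p. \<forall>z\<in>{0..1}.
      ((\<lambda>n. L (shift \<alpha> n) z) \<longlongrightarrow> snd (f (\<alpha>, L \<alpha> z))) U"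
    proof (rule minimal_idempotent_of_ultrafilter[OF U])
      show "eventually (\<lambda>n. n \<ge> 1) U"
        by (rule eventually_mono[OF ev[of "{}" "{}" 0]]) (auto simp: C_def)
      show "eventually (\<lambda>n. P m dvd n) U" for m
        by (rule eventually_mono[OF ev[of "{}" "{}" m]]) (auto simp: C_def)
      show "eventually (\<lambda>n. S (shift \<alpha> n) \<le> (1/2) ^ K) U" if "\<alpha> \<in> odometer p" for \<alpha> K
        by (rule eventually_mono[OF ev[of "{\<alpha>}" "{}" K]]) (use that in \<open>auto simp: C_def\<close>)
    qed
    then obtain f where f: "f \<in> minimal_idempotents X T"
      "\<And>x. ((\<lambda>n. L (shift (\<sigma> x) n) 0) \<longlongrightarrow> snd (f (x0 x))) U"
      using \<sigma> by (auto simp: x0_def)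
    have lim: "((\<lambda>n. d x n) \<longlongrightarrow> \<bar>snd (f (x0 x)) - A \<zeta>\<bar>) U" for x
      unfolding d_def by (intro tendsto_intros f(2))
    have "snd (f (x0 x)) = A \<zeta>" if "x \<in> R" for x
    proof -
      have "\<bar>snd (f (x0 x)) - A \<zeta>\<bar> \<le> (1/2) ^ K" for K
        by (rule tendsto_upperbound[OF lim _ nb], rule eventually_mono[OF ev[of "{}" "{x}" K]])
          (use that in \<open>auto simp: C_def\<close>)
      moreover have "(\<lambda>k. (1/2 :: real) ^ k) \<longlonglongrightarrow> 0" by (rule LIMSEQ_realpow_zero) auto
      ultimately have "\<bar>snd (f (x0 x)) - A \<zeta>\<bar> \<le> 0" by (intro LIMSEQ_le_const) auto
      then show ?thesis by simp
    qed
    moreover have "snd (f (x0 x)) \<noteq> A \<zeta>" if "x \<notin> R" for x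
    proof -
      have "contr high N / 2 \<le> \<bar>snd (f (x0 x)) - A \<zeta>\<bar>"
        by (rule tendsto_lowerbound[OF lim _ nb], rule eventually_mono[OF ev[of "{}" "{x}" 0]])
          (use that in \<open>auto simp: C_def\<close>)
      then show ?thesis using contr_pos[of high N] by auto
    qed
    ultimately show ?thesis using f(1) by blast
  qed
  then obtain f where f: "\<And>R. f R \<in> minimal_idempotents X T"
    "\<And>R x. x \<in> R \<longleftrightarrow> snd (f R (x0 x)) = A \<zeta>" by metis
  have "inj f" by (rule injI) (use f(2) in \<open>metis set_eqI\<close>)
  with f(1) show ?thesis by (auto simp: lepoll_def)
qed

end

section \<open>The equivalence\<close>

theorem theorem1:
  fixes p :: "nat \<Rightarrow> nat" and lam :: "nat \<Rightarrow> nat \<Rightarrow> real \<Rightarrow> real"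
    and X :: "((nat \<Rightarrow> nat) \<times> real) set" and T :: "(nat \<Rightarrow> nat) \<times> real \<Rightarrow> (nat \<Rightarrow> nat) \<times> real"
  defines "X \<equiv> fa_space p lam" and "T \<equiv> fa_map p lam"
  assumes "floyd_auslander p lam" and "minimal_system X T"
  shows "(nontame X T \<longleftrightarrow> (UNIV :: nat set set) \<prec> minimal_idempotents X T) \<and>
         ((UNIV :: nat set set) \<prec> minimal_idempotents X T \<longleftrightarrow>
            infinite {n. card (fa_Q p lam n) \<ge> 2})"
proof -
  interpret fa p lam by unfold_locales fact
  obtain N where N: "\<And>n. N \<le> n \<Longrightarrow> fa_Q p lam n \<noteq> {}" using fa_Q_nonempty by blast
  show ?thesis
  proof (cases "infinite {n. card (fa_Q p lam n) \<ge> 2}")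
    case True
    interpret fa_large p lam N by unfold_locales (use N True in auto)
    have "(UNIV :: nat set set) \<prec> Pow (UNIV :: nat set set)" by (rule lesspoll_Pow_self)
    also have "Pow (UNIV :: nat set set) \<lesssim> minimal_idempotents X T"
      using many_minimal_idempotents assms(4) by (simp add: X_def T_def)
    finally have "(UNIV :: nat set set) \<prec> minimal_idempotents X T" .
    moreover have "nontame X T" using nontame_large by (simp add: X_def T_def)
    ultimately show ?thesis using True by simp
  next
    case False
    then have "finite {n. card (fa_Q p lam n) \<ge> 2}" by simp
    then obtain N1 where N1: "\<forall>n\<in>{n. card (fa_Q p lam n) \<ge> 2}. n < N1"
      using finite_nat_set_iff_bounded by blast
    have small: "ellis X T \<lesssim> (UNIV :: nat set set)"
      unfolding X_def T_def
    proof (rule ellis_small)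
      fix n j assume n: "max N N1 \<le> n" and j: "j < p n" "lam n j = lam1"
      have "n \<notin> {n. card (fa_Q p lam n) \<ge> 2}" using N1 n by (meson le_trans max.cobounded2 not_le)
      then have "card (fa_Q p lam n) < 2" by simp
      then have "\<forall>i\<in>fa_Q p lam n. \<forall>j\<in>fa_Q p lam n. i = j"
        using \<open>card (fa_Q p lam n) < 2\<close> card_le_Suc0_iff_eq[OF finite_fa_Q[of n]] by simp
      moreover have "j \<in> fa_Q p lam n" using j by (simp add: fa_Q_def)
      ultimately have "fa_Q p lam n = {j}" by blast
      then show "j = Min (fa_Q p lam n)" by simp
    qed
    have "minimal_idempotents X T \<lesssim> ellis X T"
      by (rule subset_imp_lepoll) (auto simp: minimal_idempotents_def idempotents_def)
    then have "minimal_idempotents X T \<lesssim> (UNIV :: nat set set)" using small by (rule lepoll_trans)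
    then have "\<not> (UNIV :: nat set set) \<prec> minimal_idempotents X T"
      using lesspoll_trans2[of "UNIV :: nat set set" "minimal_idempotents X T" "UNIV :: nat set set"]
      by (auto simp: lesspoll_def)
    moreover have "\<not> nontame X T" using nontame_not_lepoll small by blast
    ultimately show ?thesis using False by simp
  qed
qed

end
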